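(* Let $\Gamma=\langle\eta_1,\dots,\eta_n\rangle<\mathrm{SO}(3,2)$ be a subgroup admitting a crooked Schottky domain, with associated open regions $U_1^\pm,\dots,U_n^\pm\subset\mathrm{Ein}_3$. Set $$F=\bigcap_{i=1}^n F_i,\qquad F_i=\mathrm{Ein}_3\setminus(U_i^-\cup U_i^+),\qquad \Omega=\bigcup_{\gamma\in\Gamma}\gamma(F).$$ Then $\Gamma$ is a free group, $\Omega$ is an open subset of $\mathrm{Ein}_3$, $\Gamma$ acts properly on $\Omega$, and the quotient $\Omega/\Gamma$ is compact.
   Context: $\mathbb{R}^{3,2}$ is $\mathbb{R}^5$ with $\langle x,y\rangle=x_1y_1+x_2y_2+x_3y_3-x_4y_4-x_5y_5$; $\mathcal{N}^{3,2}$ is the set of nonzero $x$ with $\langle x,x\rangle=0$; $\mathrm{Ein}_3=\mathcal{N}^{3,2}/\mathbb{R}^*$, with projection $\pi$, and $\pi(v)$ is written $(v_1:\dots:v_5)$. $\mathrm{SO}(3,2)$ acts on $\mathrm{Ein}_3$. A photon is $\pi(W\setminus\{0\})$ for $W\subset\mathbb{R}^{3,2}$ a totally isotropic plane. $\mathbb{R}^{2,1}$ is $\mathbb{R}^3$ with its standard orientation, the Lorentzian product $v\cdot w=v_1w_1+v_2w_2-v_3w_3$, and future-pointing meaning $v_3>0$; a vector is spacelike if $v\cdot v>0$, null if $v\cdot v=0$. The embedding $\iota:\mathbb{R}^{2,1}\to\mathrm{Ein}_3$ is $\iota(v)=\left(\frac{1-v\cdot v}{2}:v:\frac{1+v\cdot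 v}{2}\right)$. Set $p_\infty=(-1:0:0:0:1)$. For $u\in\mathbb{R}^{2,1}$ spacelike, $u^-,u^+$ denote future-pointing null vectors in $u^\perp$ (each determined up to positive scaling) such that $(u,u^-,u^+)$ is a positively oriented basis. For a future-pointing null vector $x$, $\mathsf{W}(x)$ is the closure of the open halfplane of those spacelike $u\in x^\perp$ for which $x$ is a positive multiple of $u^+$. The linear stem is $\mathsf{Stem}(u)=\{x\in u^\perp : x\cdot x\le 0\}$. The crooked plane with vertex $o=(0,0,0)$ and director $u$ is $\mathcal{C}(o,u)=\mathsf{Stem}(u)\cup\mathsf{W}(u^+)\cup\mathsf{W}(u^-)$. Its conformal compactification is $\overline{\mathcal{C}(o,u)}^{\mathrm{conf}}=\iota(\mathcal{C}(o,u))\cup\phi_\infty\cup\psi_\infty$, where $\phi_\infty$ (resp. $\psi_\infty$) is the photon containing $p_\infty$ and $(0:u^+:0)$ (resp. $p_\infty$ and $(0:u^-:0)$). A crooked surface is any image of $\overline{\mathcal{C}(o,u)}^{\mathrm{conf}}$ under an element of $\mathrm{SO}(3,2)$; its complement in $\mathrm{Ein}_3$ has exactly two connected components. $\Gamma=\langle\eta_1,\dots,\eta_n\rangle$ admits a crooked Schottky domain if there exist $2n$ pairwise disjoint crooked surfaces $\mathcal{S}_1^\pm,\dots,\mathcal{S}_n^\pm$, bounding $2n$ pairwise disjoint open regions $U_1^\pm,\dots,U_n^\pm$ (i.e. $U_i^\pm$ is a connected component of $\mathrm{Ein}_3\setminus\mathcal{S}_i^\pm$), such that $\eta_i(U_i^-)=\mathrm{Ein}_3\setminus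 \mathrm{cl}(U_i^+)$ for each $i=1,\dots,n$. *)

theory Defs
  imports "HOL-Analysis.Analysis" "HOL-Algebra.Elementary_Groups"
begin

section \<open>Einstein space\<close>

definition form32 :: "real^5 \<Rightarrow> real^5 \<Rightarrow> real" where
  "form32 x y = x$1 * y$1 + x$2 * y$2 + x$3 * y$3 - x$4 * y$4 - x$5 * y$5"

definition null32 :: "(real^5) set" where
  "null32 = {x. x \<noteq> 0 \<and> form32 x x = 0}"

definition null_rel :: "real^5 \<Rightarrow> real^5 \<Rightarrow> bool" where
  "null_rel x y \<longleftrightarrow> x \<in> null32 \<and> y \<in> null32 \<and> (\<exists>c. c \<noteq> 0 \<and> y = c *\<^sub>R x)"

lemma part_equivp_null_rel: "part_equivp null_rel"
proof (rule part_equivpI)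
  have "form32 (axis 1 1 + axis 5 1) (axis 1 1 + axis 5 1) = 0"
    by (simp add: form32_def axis_def)
  moreover have "(axis 1 1 + axis 5 1 :: real^5) \<noteq> 0"
    by (auto simp: vec_eq_iff axis_def intro!: exI[of _ 1])
  ultimately show "\<exists>x. null_rel x x"
    unfolding null_rel_def null32_def by (metis (mono_tags) mem_Collect_eq scaleR_one zero_neq_one)
  show "symp null_rel"
  proof (rule sympI)
    fix x y assume "null_rel x y"
    then obtain c where "x \<in> null32" "y \<in> null32" "c \<noteq> 0" "y = c *\<^sub>R x"
      by (auto simp: null_rel_def)
    then have "x = inverse c *\<^sub>R y" "inverse c \<noteq> 0" by auto
    with \<open>x \<in> null32\<close> \<open>y \<in> null32\<close> show "null_rel y x" unfolding null_rel_def by blast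
  qed
  show "transp null_rel"
  proof (rule transpI)
    fix x y z assume "null_rel x y" "null_rel y z"
    then obtain c d where "x \<in> null32" "z \<in> null32" "c \<noteq> 0" "d \<noteq> 0" "z = (d * c) *\<^sub>R x"
      by (auto simp: null_rel_def)
    moreover from this have "d * c \<noteq> 0" by simp
    ultimately show "null_rel x z" unfolding null_rel_def by blast
  qed
qed

text \<open>
  The projection onto the quotient of \<^term>\<open>null32\<close> by nonzero scalars is \<open>abs_ein3\<close>; its values
  outside \<^term>\<open>null32\<close> are meaningless.
\<close>

quotient_type ein3 = "real^5" / partial: null_rel
  by (rule part_equivp_null_rel)

definition proj :: "real^5 \<Rightarrow> ein3" where
  "proj = abs_ein3"

instantiation ein3 :: topological_space
begin

definition open_ein3 :: "ein3 set \<Rightarrow> bool" where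
  "open_ein3 U \<longleftrightarrow> openin (top_of_set null32) {x \<in> null32. proj x \<in> U}"

instance
proof
  show "open (UNIV :: ein3 set)" by (simp add: open_ein3_def)
next
  fix S T :: "ein3 set" assume "open S" "open T"
  moreover have "{x \<in> null32. proj x \<in> S \<inter> T}
      = {x \<in> null32. proj x \<in> S} \<inter> {x \<in> null32. proj x \<in> T}" by auto
  ultimately show "open (S \<inter> T)" by (simp only: open_ein3_def openin_Int)
next
  fix K :: "ein3 set set" assume "\<forall>S\<in>K. open S"
  moreover have "{x \<in> null32. proj x \<in> \<Union> K} = (\<Union>S\<in>K. {x \<in> null32. proj x \<in> S})" by auto
  ultimately show "open (\<Union> K)" unfolding open_ein3_def by (simp only:) blast
qed

end

definition SO32 :: "(real^5^5) monoid" where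
  "SO32 = \<lparr>carrier = {A. (\<forall>x y. form32 (A *v x) (A *v y) = form32 x y) \<and> det A = 1},
           mult = (**), one = mat 1\<rparr>"

definition act :: "real^5^5 \<Rightarrow> ein3 \<Rightarrow> ein3" where
  "act A p = proj (A *v rep_ein3 p)"

definition photon :: "ein3 set \<Rightarrow> bool" where
  "photon P \<longleftrightarrow> (\<exists>W. subspace W \<and> dim W = 2 \<and> (\<forall>x\<in>W. \<forall>y\<in>W. form32 x y = 0)
                     \<and> P = proj ` (W - {0}))"

section \<open>Crooked surfaces\<close>

definition lor :: "real^3 \<Rightarrow> real^3 \<Rightarrow> real" where
  "lor v w = v$1 * w$1 + v$2 * w$2 - v$3 * w$3"

definition spacelike :: "real^3 \<Rightarrow> bool" where
  "spacelike v \<longleftrightarrow> lor v v > 0"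

definition future_null :: "real^3 \<Rightarrow> bool" where
  "future_null v \<longleftrightarrow> lor v v = 0 \<and> v$3 > 0"

text \<open>
  \<open>null_frame u a b\<close>: the vectors \<open>a\<close> and \<open>b\<close> are admissible choices of $u^-$ and $u^+$.
  Every set built from them below is invariant under positive rescaling of \<open>a\<close> and \<open>b\<close>.
\<close>

definition null_frame :: "real^3 \<Rightarrow> real^3 \<Rightarrow> real^3 \<Rightarrow> bool" where
  "null_frame u a b \<longleftrightarrow> spacelike u \<and> future_null a \<and> future_null b
     \<and> lor a u = 0 \<and> lor b u = 0 \<and> det (vector [u, a, b] :: real^3^3) > 0"

definition wing :: "real^3 \<Rightarrow> (real^3) set" where
  "wing x = closure {u. spacelike u \<and> lor u x = 0
                        \<and> (\<exists>a b c. null_frame u a b \<and> c > 0 \<and> x = c *\<^sub>R b)}"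

definition stem :: "real^3 \<Rightarrow> (real^3) set" where
  "stem u = {x. lor x u = 0 \<and> lor x x \<le> 0}"

definition emb :: "real^3 \<Rightarrow> ein3" where
  "emb v = proj (vector [(1 - lor v v) / 2, v$1, v$2, v$3, (1 + lor v v) / 2])"

definition p_infinity :: ein3 where
  "p_infinity = proj (vector [-1, 0, 0, 0, 1])"

definition ideal_point :: "real^3 \<Rightarrow> ein3" where
  "ideal_point v = proj (vector [0, v$1, v$2, v$3, 0])"

text \<open>
  \<open>compactified_crooked_plane u S\<close>: the set \<open>S\<close> is the conformal compactification of the crooked
  plane with vertex the origin and director \<open>u\<close>.
\<close>

definition compactified_crooked_plane :: "real^3 \<Rightarrow> ein3 set \<Rightarrow> bool" where
  "compactified_crooked_plane u S \<longleftrightarrow>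
     (\<exists>um up \<phi> \<psi>. null_frame u um up
        \<and> photon \<phi> \<and> p_infinity \<in> \<phi> \<and> ideal_point up \<in> \<phi>
        \<and> photon \<psi> \<and> p_infinity \<in> \<psi> \<and> ideal_point um \<in> \<psi>
        \<and> S = emb ` (stem u \<union> wing up \<union> wing um) \<union> \<phi> \<union> \<psi>)"

definition crooked_surface :: "ein3 set \<Rightarrow> bool" where
  "crooked_surface S \<longleftrightarrow>
     (\<exists>u C A. spacelike u \<and> compactified_crooked_plane u C \<and> A \<in> carrier SO32 \<and> S = act A ` C)"

text \<open>
  \<open>U i True\<close> and \<open>U i False\<close> stand for $U_i^+$ and $U_i^-$, for \<open>i\<close> in \<open>{1..n}\<close>.
\<close>

definition crooked_schottky_domain ::
    "nat \<Rightarrow> (nat \<Rightarrow> real^5^5) \<Rightarrow> (nat \<Rightarrow> bool \<Rightarrow> ein3 set) \<Rightarrow> bool" where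
  "crooked_schottky_domain n \<eta> U \<longleftrightarrow>
     (\<exists>S :: nat \<Rightarrow> bool \<Rightarrow> ein3 set.
        (\<forall>i\<in>{1..n}. \<forall>s. crooked_surface (S i s) \<and> U i s \<in> components (- S i s))
        \<and> disjoint_family_on (\<lambda>(i, s). S i s) ({1..n} \<times> UNIV)
        \<and> disjoint_family_on (\<lambda>(i, s). U i s) ({1..n} \<times> UNIV)
        \<and> (\<forall>i\<in>{1..n}. act (\<eta> i) ` U i False = - closure (U i True)))"

section \<open>Free groups\<close>

text \<open>
  A letter \<open>(x, s)\<close> stands for \<open>x\<close> if \<open>s\<close> holds and for the inverse of \<open>x\<close> otherwise.
\<close>

definition word_value :: "('a, 'b) monoid_scheme \<Rightarrow> ('a \<times> bool) list \<Rightarrow> 'a" where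
  "word_value G w =
     foldr (\<lambda>(x, s) y. (if s then x else inv\<^bsub>G\<^esub> x) \<otimes>\<^bsub>G\<^esub> y) w \<one>\<^bsub>G\<^esub>"

definition reduced_word :: "('a \<times> bool) list \<Rightarrow> bool" where
  "reduced_word w \<longleftrightarrow> successively (\<lambda>p q. \<not> (fst p = fst q \<and> snd p \<noteq> snd q)) w"

definition free_basis :: "('a, 'b) monoid_scheme \<Rightarrow> 'a set \<Rightarrow> bool" where
  "free_basis G X \<longleftrightarrow> X \<subseteq> carrier G \<and> generate G X = carrier G
     \<and> (\<forall>w. w \<noteq> [] \<and> set w \<subseteq> X \<times> UNIV \<and> reduced_word w \<longrightarrow> word_value G w \<noteq> \<one>\<^bsub>G\<^esub>)"

definition free_group :: "('a, 'b) monoid_scheme \<Rightarrow> bool" where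
  "free_group G \<longleftrightarrow> group G \<and> (\<exists>X. free_basis G X)"

section \<open>Proper actions and orbit spaces\<close>

text \<open>
  The acting group carries the discrete topology, so its compact subsets are the finite ones.
\<close>

definition acts_properly_on :: "(real^5^5) set \<Rightarrow> ein3 set \<Rightarrow> bool" where
  "acts_properly_on \<Gamma> X \<longleftrightarrow> (\<forall>\<gamma>\<in>\<Gamma>. act \<gamma> ` X = X)
     \<and> (\<forall>K. K \<subseteq> X \<and> compact K \<longrightarrow> finite {\<gamma> \<in> \<Gamma>. act \<gamma> ` K \<inter> K \<noteq> {}})"

definition orbit_of :: "(real^5^5) set \<Rightarrow> ein3 \<Rightarrow> ein3 set" where
  "orbit_of \<Gamma> p = (\<lambda>\<gamma>. act \<gamma> p) ` \<Gamma>"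

definition quotient_topology :: "'a topology \<Rightarrow> ('a \<Rightarrow> 'b) \<Rightarrow> 'b topology" where
  "quotient_topology X f =
     topology (\<lambda>V. V \<subseteq> f ` topspace X \<and> openin X {x \<in> topspace X. f x \<in> V})"

lemma openin_quotient_topology:
  "openin (quotient_topology X f) V \<longleftrightarrow>
     V \<subseteq> f ` topspace X \<and> openin X {x \<in> topspace X. f x \<in> V}"
proof -
  have "istopology (\<lambda>V. V \<subseteq> f ` topspace X \<and> openin X {x \<in> topspace X. f x \<in> V})"
    unfolding istopology_def
  proof (intro conjI allI impI)
    fix S T assume *: "S \<subseteq> f ` topspace X \<and> openin X {x \<in> topspace X. f x \<in> S}"
      "T \<subseteq> f ` topspace X \<and> openin X {x \<in> topspace X. f x \<in> T}"
    then show "S \<inter> T \<subseteq> f ` topspace X" by auto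
    have "{x \<in> topspace X. f x \<in> S \<inter> T}
        = {x \<in> topspace X. f x \<in> S} \<inter> {x \<in> topspace X. f x \<in> T}" by auto
    with * show "openin X {x \<in> topspace X. f x \<in> S \<inter> T}" by (simp only: openin_Int)
  next
    fix K assume *: "\<forall>S\<in>K. S \<subseteq> f ` topspace X \<and> openin X {x \<in> topspace X. f x \<in> S}"
    then show "\<Union> K \<subseteq> f ` topspace X" by auto
    have "{x \<in> topspace X. f x \<in> \<Union> K} = (\<Union>S\<in>K. {x \<in> topspace X. f x \<in> S})" by auto
    with * show "openin X {x \<in> topspace X. f x \<in> \<Union> K}" by (simp only:) blast
  qed
  then show ?thesis unfolding quotient_topology_def by (simp add: topology_inverse')
qed

definition orbit_space :: "(real^5^5) set \<Rightarrow> ein3 set \<Rightarrow> ein3 set topology" where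
  "orbit_space \<Gamma> X = quotient_topology (top_of_set X) (orbit_of \<Gamma>)"

end

(* The group part is ping-pong: eta_i maps the complement of U_i^- onto the closure of U_i^+, and the
   reverse inclusion for the inverse needs U_i^+ to be regular open (the interior of its closure).
   Then a reduced word of length at least two moves F into one of the U's, so only the generators
   and their inverses can translate F onto a set meeting F, and F together with these finitely many
   translates is a neighbourhood of F.

   The geometric input is that a crooked surface separates locally on both sides.  In coordinates
   (x, y, z) dual to the frame (u, u^-, u^+) and with l = v_1 + v_5, the surface is the set
   {x = 0, yz >= 0} u {y = 0, xl >= 0} u {z = 0, xl <= 0} of the null cone, and its complement is the
   union of two open sets, exchanged by (y, z) -> (-y, -z), each having the surface in its closure. *)

theory Submission
  imports Defs
begin

text \<open>The hypotheses say what \<eta>_i does to one region only. Reading off its inverse in the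
  same way requires that no point of the surface be interior to the closure of U_i^+. Being
  two-sided gives this: the region is connected, so it lies in one of the two open sides, its
  closure misses the other side, and that other side accumulates at every point of the surface.
  Where l is nonzero, a point of the surface is pushed into either side by moving x, y, z freely and
  solving the equation of the cone for v_5 - v_1. At l = 0 the equation cannot be solved in this
  way, so points at infinity are first approximated by points of the surface with l nonzero.\<close>

lemma exhaust_5:
  fixes x :: 5
  shows "x = 1 \<or> x = 2 \<or> x = 3 \<or> x = 4 \<or> x = 5"
proof (induct x)
  case (of_int z)
  then have "0 \<le> z" and "z < 5" by simp_all
  then have "z = 0 \<or> z = 1 \<or> z = 2 \<or> z = 3 \<or> z = 4" by arith
  then show ?case by auto
qed

lemma forall_5: "(\<forall>i::5. P i) \<longleftrightarrow> P 1 \<and> P 2 \<and> P 3 \<and> P 4 \<and> P 5"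
  by (metis exhaust_5)

lemma vector_5 [simp]:
  "(vector [a, b, c, d, e] :: 'a::zero^5)$1 = a"
  "(vector [a, b, c, d, e] :: 'a::zero^5)$2 = b"
  "(vector [a, b, c, d, e] :: 'a::zero^5)$3 = c"
  "(vector [a, b, c, d, e] :: 'a::zero^5)$4 = d"
  "(vector [a, b, c, d, e] :: 'a::zero^5)$5 = e"
  unfolding vector_def by simp_all

subsection \<open>The projection and the action\<close>

lemma proj_eq_iff: "\<lbrakk>x \<in> null32; y \<in> null32\<rbrakk> \<Longrightarrow> proj x = proj y \<longleftrightarrow> (\<exists>c. c \<noteq> 0 \<and> y = c *\<^sub>R x)"
  unfolding proj_def using Quotient3_rel[OF Quotient3_ein3, of x y]
  by (auto simp: null_rel_def intro: exI[of _ 1])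

lemma form32_scaleR: "form32 (c *\<^sub>R x) (c *\<^sub>R y) = c\<^sup>2 * form32 x y"
  by (simp add: form32_def power2_eq_square algebra_simps)

lemma scaleR_null32: "\<lbrakk>x \<in> null32; c \<noteq> 0\<rbrakk> \<Longrightarrow> c *\<^sub>R x \<in> null32"
  by (simp add: null32_def form32_scaleR)

lemma proj_scaleR: "\<lbrakk>x \<in> null32; c \<noteq> 0\<rbrakk> \<Longrightarrow> proj (c *\<^sub>R x) = proj x"
  using proj_eq_iff[OF _ scaleR_null32, of x x c] by auto

lemma rep_ein3_null: "rep_ein3 p \<in> null32"
  using Quotient3_rep_reflp[OF Quotient3_ein3, of p] by (simp add: null_rel_def)

lemma proj_rep_ein3: "proj (rep_ein3 p) = p"
  unfolding proj_def by (rule Quotient3_abs_rep[OF Quotient3_ein3])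

lemma ein3_cases: obtains x where "x \<in> null32" "p = proj x"
  using rep_ein3_null proj_rep_ein3 by metis

lemma open_ein3_iff: "open U \<longleftrightarrow> openin (top_of_set null32) {x \<in> null32. proj x \<in> U}"
  for U :: "ein3 set"
  by (simp add: open_ein3_def)

lemma continuous_on_proj: "continuous_on null32 proj"
  by (simp add: continuous_on_open_invariant open_ein3_iff openin_open Int_def vimage_def)
    (metis (no_types, lifting) Collect_cong)

text \<open>
  The part of $(\mathbb{R}^3 \setminus 0) \times (\mathbb{R}^2 \setminus 0)$ where the two norms
  agree is the null cone; rescaling makes the norms agree and presents the Einstein space as a
  quotient of an open subset of a Euclidean space.
\<close>

definition ein_chart :: "(real^3) \<times> (real^2) \<Rightarrow> real^5" where
  "ein_chart = (\<lambda>(a, b). vector [norm b * a$1, norm b * a$2, norm b * a$3,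
                                 norm a * b$1, norm a * b$2])"

definition ein_unchart :: "real^5 \<Rightarrow> (real^3) \<times> (real^2)" where
  "ein_unchart x = (vector [x$1, x$2, x$3], vector [x$4, x$5])"

abbreviation punctured_pairs :: "((real^3) \<times> (real^2)) set" where
  "punctured_pairs \<equiv> (- {0}) \<times> (- {0})"

lemma norm_sq_3: "(norm (a :: real^3))\<^sup>2 = (a$1)\<^sup>2 + (a$2)\<^sup>2 + (a$3)\<^sup>2"
  by (simp only: power2_norm_eq_inner inner_vec_def sum_3) (simp add: power2_eq_square)

lemma norm_sq_2: "(norm (a :: real^2))\<^sup>2 = (a$1)\<^sup>2 + (a$2)\<^sup>2"
  by (simp only: power2_norm_eq_inner inner_vec_def sum_2) (simp add: power2_eq_square)

lemma vec_eq_0_3: "(a :: real^3) = 0 \<longleftrightarrow> a$1 = 0 \<and> a$2 = 0 \<and> a$3 = 0"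
  by (simp add: vec_eq_iff forall_3)

lemma vec_eq_0_2: "(a :: real^2) = 0 \<longleftrightarrow> a$1 = 0 \<and> a$2 = 0"
  by (simp add: vec_eq_iff forall_2)

lemma vec_eq_0_5: "(a :: real^5) = 0 \<longleftrightarrow> a$1 = 0 \<and> a$2 = 0 \<and> a$3 = 0 \<and> a$4 = 0 \<and> a$5 = 0"
  by (simp add: vec_eq_iff forall_5)

lemma ein_chart_null: "p \<in> punctured_pairs \<Longrightarrow> ein_chart p \<in> null32"
proof -
  assume "p \<in> punctured_pairs"
  then obtain a b where p: "p = (a, b)" "a \<noteq> 0" "b \<noteq> 0" by auto
  have "form32 (ein_chart p) (ein_chart p)
      = (norm b)\<^sup>2 * ((a$1)\<^sup>2 + (a$2)\<^sup>2 + (a$3)\<^sup>2) - (norm a)\<^sup>2 * ((b$1)\<^sup>2 + (b$2)\<^sup>2)"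
    by (simp add: p form32_def ein_chart_def power2_eq_square algebra_simps)
  also have "\<dots> = 0"
    by (simp flip: norm_sq_3 norm_sq_2)
  finally show ?thesis
    using p by (auto simp: null32_def ein_chart_def vec_eq_0_5 vec_eq_0_3)
qed

text \<open>On the null cone the two blocks have equal norm, so if one vanished then so would the
  other.\<close>

lemma ein_unchart_punctured:
  assumes "x \<in> null32" shows "ein_unchart x \<in> punctured_pairs"
proof -
  have *: "(x$1)\<^sup>2 + (x$2)\<^sup>2 + (x$3)\<^sup>2 = (x$4)\<^sup>2 + (x$5)\<^sup>2" and "x \<noteq> 0"
    using assms by (auto simp: null32_def form32_def power2_eq_square)
  have "x$1 = 0 \<and> x$2 = 0 \<and> x$3 = 0 \<longleftrightarrow> x$4 = 0 \<and> x$5 = 0"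
    using * by (smt (verit) power_zero_numeral sum_power2_eq_zero_iff zero_le_power2)
  then show ?thesis
    using \<open>x \<noteq> 0\<close> by (auto simp: ein_unchart_def vec_eq_0_5 vec_eq_0_3 vec_eq_0_2)
qed

text \<open>With both blocks of norm \<open>r\<close>, the chart multiplies the vector by
  \<open>r\<close>; only its projective class is recovered.\<close>

lemma ein_chart_unchart:
  assumes "x \<in> null32" shows "proj (ein_chart (ein_unchart x)) = proj x"
proof -
  have *: "(x$1)\<^sup>2 + (x$2)\<^sup>2 + (x$3)\<^sup>2 = (x$4)\<^sup>2 + (x$5)\<^sup>2"
    using assms by (auto simp: null32_def form32_def power2_eq_square)
  define r where "r = norm (vector [x$1, x$2, x$3] :: real^3)"
  have "r\<^sup>2 = (norm (vector [x$4, x$5] :: real^2))\<^sup>2"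
    unfolding r_def norm_sq_3 norm_sq_2 using * by simp
  then have r: "norm (vector [x$4, x$5] :: real^2) = r"
    by (simp add: r_def power2_eq_iff_nonneg)
  have "r \<noteq> 0"
    using ein_unchart_punctured[OF assms] by (simp add: r_def ein_unchart_def)
  moreover have "ein_chart (ein_unchart x) = r *\<^sub>R x"
    by (simp add: ein_chart_def ein_unchart_def r vec_eq_iff forall_5 flip: r_def)
  ultimately show ?thesis using assms by (simp add: proj_scaleR)
qed

lemma continuous_on_vector_5:
  assumes "continuous_on S f1" "continuous_on S f2" "continuous_on S f3" "continuous_on S f4"
    "continuous_on S f5"
  shows "continuous_on S (\<lambda>x. vector [f1 x, f2 x, f3 x, f4 x, f5 x] :: real^5)"
proof -
  have "(\<lambda>x. vector [f1 x, f2 x, f3 x, f4 x, f5 x] :: real^5)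
      = (\<lambda>x. f1 x *\<^sub>R axis 1 1 + f2 x *\<^sub>R axis 2 1 + f3 x *\<^sub>R axis 3 1 + f4 x *\<^sub>R axis 4 1
             + f5 x *\<^sub>R axis 5 1)"
    by (simp add: fun_eq_iff vec_eq_iff forall_5 axis_def)
  then show ?thesis by (simp only:) (intro continuous_intros assms)
qed

lemma continuous_on_ein_chart: "continuous_on S ein_chart"
  unfolding ein_chart_def split_def by (intro continuous_on_vector_5 continuous_intros)

lemma continuous_on_ein_unchart: "continuous_on S ein_unchart"
proof -
  have "ein_unchart = (\<lambda>x. (x$1 *\<^sub>R axis 1 1 + x$2 *\<^sub>R axis 2 1 + x$3 *\<^sub>R axis 3 1,
                            x$4 *\<^sub>R axis 1 1 + x$5 *\<^sub>R axis 2 1))"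
    by (simp add: ein_unchart_def fun_eq_iff vec_eq_iff forall_3 forall_2 axis_def)
  then show ?thesis by (rule ssubst) (intro continuous_intros)
qed

lemma continuous_on_proj_ein_chart: "continuous_on punctured_pairs (proj \<circ> ein_chart)"
  using ein_chart_null
  by (intro continuous_on_compose continuous_on_ein_chart continuous_on_subset[OF continuous_on_proj]) auto

lemma proj_ein_chart_image: "(proj \<circ> ein_chart) ` punctured_pairs = UNIV"
proof -
  have "p \<in> (proj \<circ> ein_chart) ` punctured_pairs" for p
    by (rule ein3_cases[of p]) (metis ein_chart_unchart ein_unchart_punctured comp_apply imageI)
  then show ?thesis by auto
qed

text \<open>The chart has a connected domain: punctured Euclidean spaces of dimension at least 2 are
  connected.\<close>

lemma connected_UNIV_ein3: "connected (UNIV :: ein3 set)"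
  unfolding proj_ein_chart_image[symmetric]
  by (intro connected_continuous_image continuous_on_proj_ein_chart connected_Times
      connected_punctured_universe) auto

text \<open>Normalising the two blocks separately changes the chart by a scalar only, so the product
  of the two unit spheres already covers Einstein space.\<close>

lemma compact_UNIV_ein3: "compact (UNIV :: ein3 set)"
proof -
  have "p \<in> (proj \<circ> ein_chart) ` (sphere 0 1 \<times> sphere 0 1)" for p
  proof -
    obtain x where x: "x \<in> null32" "p = proj x" by (rule ein3_cases)
    obtain a b where ab: "ein_unchart x = (a, b)" by (cases "ein_unchart x")
    then have nz: "a \<noteq> 0" "b \<noteq> 0" using ein_unchart_punctured[OF x(1)] by auto
    define q where "q = ((1 / norm a) *\<^sub>R a, (1 / norm b) *\<^sub>R b)"
    have "ein_chart q = (1 / (norm a * norm b)) *\<^sub>R ein_chart (a, b)"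
      using nz unfolding vec_eq_iff[of "ein_chart q"] forall_5
      by (simp add: q_def ein_chart_def)
    moreover have "proj (ein_chart (a, b)) = p"
      using ein_chart_unchart[OF x(1)] ab x by simp
    moreover have "ein_chart (a, b) \<in> null32" using nz by (intro ein_chart_null) auto
    ultimately have "proj (ein_chart q) = p" using nz by (simp add: proj_scaleR)
    moreover have "q \<in> sphere 0 1 \<times> sphere 0 1" using nz by (simp add: q_def)
    ultimately show ?thesis by force
  qed
  then have *: "(proj \<circ> ein_chart) ` (sphere 0 1 \<times> sphere 0 1) = UNIV" by blast
  show ?thesis
    unfolding *[symmetric]
    by (intro compact_continuous_image compact_Times compact_sphere
        continuous_on_subset[OF continuous_on_proj_ein_chart]) auto
qed

text \<open>The chart is a quotient map because \<open>ein_unchart\<close> is a continuous right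
  inverse of it up to scaling, and local connectedness passes to quotients. This is what makes the
  components of an open set open.\<close>

lemma locally_connected_UNIV_ein3: "locally connected (UNIV :: ein3 set)"
  unfolding proj_ein_chart_image[symmetric]
proof (rule locally_connected_quotient_image)
  show "locally connected punctured_pairs"
    by (intro locally_open_subset[OF locally_connected_UNIV]) (auto intro!: open_Times)
next
  fix T :: "ein3 set"
  show "openin (top_of_set punctured_pairs) (punctured_pairs \<inter> (proj \<circ> ein_chart) -` T) \<longleftrightarrow>
        openin (top_of_set ((proj \<circ> ein_chart) ` punctured_pairs)) T"
  proof
    assume "openin (top_of_set punctured_pairs) (punctured_pairs \<inter> (proj \<circ> ein_chart) -` T)"
    then have "openin (top_of_set null32)
                 (null32 \<inter> ein_unchart -` (punctured_pairs \<inter> (proj \<circ> ein_chart) -` T))"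
      by (intro continuous_openin_preimage[OF continuous_on_ein_unchart])
        (use ein_unchart_punctured in auto)
    moreover have "null32 \<inter> ein_unchart -` (punctured_pairs \<inter> (proj \<circ> ein_chart) -` T)
                 = {x \<in> null32. proj x \<in> T}"
      using ein_unchart_punctured ein_chart_unchart by fastforce
    ultimately show "openin (top_of_set ((proj \<circ> ein_chart) ` punctured_pairs)) T"
      unfolding proj_ein_chart_image by (simp add: open_ein3_iff)
  next
    assume "openin (top_of_set ((proj \<circ> ein_chart) ` punctured_pairs)) T"
    then show "openin (top_of_set punctured_pairs) (punctured_pairs \<inter> (proj \<circ> ein_chart) -` T)"
      by (intro continuous_openin_preimage[OF continuous_on_proj_ein_chart]) auto
  qed
qed

lemma open_component_ein3:
  fixes S :: "ein3 set"
  assumes "closed S" "C \<in> components (- S)"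
  shows "open C"
proof -
  have "locally connected (- S)"
    using locally_open_subset[OF locally_connected_UNIV_ein3] assms by (simp add: open_Compl)
  then have "openin (top_of_set (- S)) C"
    using assms openin_components_locally_connected by blast
  then show ?thesis using assms by (simp add: open_Compl openin_open_eq)
qed

section \<open>The group SO(3,2) and its continuous action on Einstein space\<close>

lemma SO32_null32: "\<lbrakk>A \<in> carrier SO32; x \<in> null32\<rbrakk> \<Longrightarrow> A *v x \<in> null32"
proof -
  assume A: "A \<in> carrier SO32" and x: "x \<in> null32"
  have "invertible A" using A by (simp add: SO32_def invertible_det_nz)
  then have "A *v x \<noteq> 0"
    using x matrix_left_invertible_ker[of A] by (auto simp: invertible_def null32_def)
  then show ?thesis using A x by (simp add: SO32_def null32_def)
qed

lemma SO32_group: "group SO32"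
proof (rule groupI)
  fix A assume A: "A \<in> carrier SO32"
  then have "invertible A" by (simp add: SO32_def invertible_det_nz)
  then obtain B where B: "A ** B = mat 1" "B ** A = mat 1" by (auto simp: invertible_def)
  have "det A * det B = 1" using B(1) det_mul[of A B] by simp
  then have "det B = 1" using A by (simp add: SO32_def)
  moreover have "form32 (B *v x) (B *v y) = form32 x y" for x y
  proof -
    have "form32 (B *v x) (B *v y) = form32 (A *v (B *v x)) (A *v (B *v y))"
      using A by (simp add: SO32_def)
    then show ?thesis by (simp add: matrix_vector_mul_assoc B)
  qed
  ultimately show "\<exists>y\<in>carrier SO32. y \<otimes>\<^bsub>SO32\<^esub> A = \<one>\<^bsub>SO32\<^esub>"
    using B by (auto simp: SO32_def)
qed (auto simp: SO32_def det_mul matrix_mul_assoc simp flip: matrix_vector_mul_assoc)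

text \<open>\<open>act\<close> is defined through a chosen representative; by linearity any other
  null representative gives the same point.\<close>

lemma act_proj:
  assumes "A \<in> carrier SO32" "x \<in> null32"
  shows "act A (proj x) = proj (A *v x)"
proof -
  obtain c where c: "c \<noteq> 0" "rep_ein3 (proj x) = c *\<^sub>R x"
    using proj_eq_iff[OF assms(2) rep_ein3_null[of "proj x"]] proj_rep_ein3[of "proj x"] by auto
  have "act A (proj x) = proj (c *\<^sub>R (A *v x))"
    by (simp add: act_def c matrix_vector_mult_scaleR)
  then show ?thesis
    using c SO32_null32[OF assms] by (simp add: proj_scaleR)
qed

lemma act_one: "act \<one>\<^bsub>SO32\<^esub> p = p"
  by (simp add: act_def SO32_def proj_rep_ein3)

lemma act_mult:
  assumes "A \<in> carrier SO32" "B \<in> carrier SO32"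
  shows "act (A \<otimes>\<^bsub>SO32\<^esub> B) p = act A (act B p)"
proof -
  obtain x where x: "x \<in> null32" "p = proj x" by (rule ein3_cases)
  have "A \<otimes>\<^bsub>SO32\<^esub> B \<in> carrier SO32"
    using assms SO32_group by (simp add: group.is_monoid monoid.m_closed)
  then show ?thesis
    using assms x SO32_null32 by (simp add: act_proj) (simp add: SO32_def matrix_vector_mul_assoc)
qed

lemma continuous_act:
  assumes "A \<in> carrier SO32"
  shows "continuous_on UNIV (act A)"
proof -
  have "open (act A -` T)" if T: "open T" for T
  proof -
    have "openin (top_of_set null32) (null32 \<inter> (\<lambda>x. A *v x) -` {x \<in> null32. proj x \<in> T})"
      using T SO32_null32[OF assms]
      by (intro continuous_openin_preimage[of _ _ null32])
        (auto simp: open_ein3_iff intro!: matrix_vector_mult_linear_continuous_on)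
    moreover have "null32 \<inter> (\<lambda>x. A *v x) -` {x \<in> null32. proj x \<in> T} = {x \<in> null32. proj x \<in> act A -` T}"
      using SO32_null32[OF assms] by (auto simp: act_proj[OF assms])
    ultimately show ?thesis by (simp add: open_ein3_iff)
  qed
  then show ?thesis by (simp add: continuous_on_open_vimage)
qed

subsection \<open>Crooked surfaces in homogeneous coordinates\<close>

text \<open>
  \<open>x\<close>, \<open>y\<close>, \<open>z\<close> stand for positive multiples of the coordinates of $(v_2, v_3, v_4)$ in the
  frame $(u, u^-, u^+)$, and \<open>l\<close> for $v_1 + v_5$.  For \<open>l = 1\<close> the three disjuncts of
  \<open>crooked_sign\<close> are the stem and the wings of $u^+$ and $u^-$; for \<open>l = 0\<close> the equation of the null
  cone turns them into the two photons at infinity.  The two sides \<open>side_sign 1\<close> and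
  \<open>side_sign (-1)\<close> are exchanged by negating \<open>y\<close> and \<open>z\<close>.
\<close>

definition crooked_sign :: "real \<Rightarrow> real \<Rightarrow> real \<Rightarrow> real \<Rightarrow> bool" where
  "crooked_sign x y z l \<longleftrightarrow> x = 0 \<and> y * z \<ge> 0 \<or> y = 0 \<and> x * l \<ge> 0 \<or> z = 0 \<and> x * l \<le> 0"

definition side_sign :: "real \<Rightarrow> real \<Rightarrow> real \<Rightarrow> real \<Rightarrow> real \<Rightarrow> bool" where
  "side_sign e x y z l \<longleftrightarrow> y * z < 0 \<and> e * (y * l) > 0 \<or> x * l > 0 \<and> e * (x * y) > 0
     \<or> x * l < 0 \<and> e * (x * z) > 0 \<or> e * (x * y) > 0 \<and> e * (x * z) > 0"

text \<open>Apart from equations to zero, both sign predicates see only products of two coordinates,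
  so a common factor \<open>c\<close> of either sign enters as the positive number c^2. Hence they
  depend only on the projective class.\<close>

lemma scaled_product_sign:
  fixes c p r :: real
  assumes "c \<noteq> 0"
  shows "0 < c * p * (c * r) \<longleftrightarrow> 0 < p * r" "c * p * (c * r) < 0 \<longleftrightarrow> p * r < 0"
    "0 \<le> c * p * (c * r) \<longleftrightarrow> 0 \<le> p * r" "c * p * (c * r) \<le> 0 \<longleftrightarrow> p * r \<le> 0"
    "0 < e * (c * p * (c * r)) \<longleftrightarrow> 0 < e * (p * r)"
proof -
  have c: "c\<^sup>2 > 0" using assms by simp
  have *: "c * p * (c * r) = c\<^sup>2 * (p * r)"
    by (simp add: power2_eq_square)
  note lt = mult_less_cancel_left_pos[OF c] and le = mult_le_cancel_left_pos[OF c]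
  show "0 < c * p * (c * r) \<longleftrightarrow> 0 < p * r" "c * p * (c * r) < 0 \<longleftrightarrow> p * r < 0"
    "0 \<le> c * p * (c * r) \<longleftrightarrow> 0 \<le> p * r" "c * p * (c * r) \<le> 0 \<longleftrightarrow> p * r \<le> 0"
    "0 < e * (c * p * (c * r)) \<longleftrightarrow> 0 < e * (p * r)"
    using lt[of 0 "p * r"] lt[of "p * r" 0] le[of 0 "p * r"] le[of "p * r" 0] lt[of 0 "e * (p * r)"]
    unfolding * by (simp_all only: mult_zero_right mult.left_commute[of e "c\<^sup>2"])
qed

lemma crooked_sign_scale:
  "c \<noteq> 0 \<Longrightarrow> crooked_sign (c * x) (c * y) (c * z) (c * l) = crooked_sign x y z l"
  by (simp only: crooked_sign_def scaled_product_sign mult_eq_0_iff simp_thms)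

lemma side_sign_scale:
  "c \<noteq> 0 \<Longrightarrow> side_sign e (c * x) (c * y) (c * z) (c * l) = side_sign e x y z l"
  by (simp only: side_sign_def scaled_product_sign simp_thms)

text \<open>For l nonzero, the sign of x * l decides whether the sign of y or that of z separates
  the sides, and on x = 0 the two signs are opposite off the stem and agree on the side. For l = 0
  the hypothesis on the cone gives y * z > 0 when x is nonzero, so the last disjunct of
  \<open>side_sign\<close> decides, while x = 0 forces y * z = 0, which is on the surface.\<close>

lemma not_crooked_sign_iff:
  fixes c d :: real
  assumes "c > 0" "d > 0" "x\<^sup>2 / c - 2 * y * z / d = l * m"
  shows "\<not> crooked_sign x y z l \<longleftrightarrow> side_sign 1 x y z l \<or> side_sign (-1) x y z l"
proof -
  have l0: "x\<^sup>2 * d = 2 * c * (y * z)" if "l = 0"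
    using assms that by (simp add: field_simps)
  have "y * z > 0" if "l = 0" "x \<noteq> 0"
  proof -
    have "0 < 2 * c * (y * z)" using l0 that assms by (metis mult_pos_pos zero_less_power2)
    then show ?thesis using assms by (simp add: zero_less_mult_iff)
  qed
  moreover have "y * z = 0" if "l = 0" "x = 0"
    using l0 that assms by simp
  ultimately show ?thesis
    unfolding crooked_sign_def side_sign_def
    by (cases x "0::real" rule: linorder_cases; cases y "0::real" rule: linorder_cases;
        cases z "0::real" rule: linorder_cases; cases l "0::real" rule: linorder_cases)
      (simp_all add: zero_le_mult_iff mult_le_0_iff zero_less_mult_iff mult_less_0_iff)
qed

lemma side_sign_disjoint: "\<not> (side_sign 1 x y z l \<and> side_sign (-1) x y z l)"
  unfolding side_sign_def
  by (cases x "0::real" rule: linorder_cases; cases y "0::real" rule: linorder_cases;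
      cases z "0::real" rule: linorder_cases; cases l "0::real" rule: linorder_cases)
    (simp_all add: zero_less_mult_iff mult_less_0_iff)

text \<open>Two straight moves are available: into x * l > 0 with y pushed towards side
  \<open>e\<close>, or into x * l < 0 with z pushed towards it. One of them starts with both
  relevant signs already weakly correct, so the signs become strict for every t > 0 and t need not
  be small.\<close>

lemma crooked_sign_perturb:
  assumes "crooked_sign x y z l" "l \<noteq> 0" "e = 1 \<or> e = -1"
  shows "(\<forall>t>0. side_sign e (x + t * l) (y + t * (e * l)) z l) \<or>
         (\<forall>t>0. side_sign e (x + t * (- l)) y (z + t * (- e * l)) l)"
proof -
  have e: "e * e = 1" and l: "l\<^sup>2 > 0" using assms by auto
  have pos: "w > 0" if "p * q = w * l\<^sup>2" "p * q > 0" for p q w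
    using that zero_less_mult_pos2[OF _ l] by metis
  \<comment> \<open>On a wing the sign of x * l selects the move. On the stem, y * z \<ge> 0
    prevents y and z from both having the wrong sign.\<close>
  have "x * l \<ge> 0 \<and> e * (y * l) \<ge> 0 \<or> x * l \<le> 0 \<and> e * (z * l) \<le> 0"
  proof (cases "x = 0 \<and> y * z \<ge> 0")
    case True
    have "(e * (y * l)) * (e * (z * l)) = (y * z) * l\<^sup>2 * (e * e)"
      by (simp add: power2_eq_square algebra_simps)
    then have "(e * (y * l)) * (e * (z * l)) = (y * z) * l\<^sup>2" by (simp only: e mult_1_right)
    then have "(e * (y * l)) * (e * (z * l)) \<ge> 0"
      using True by (simp only: zero_le_power2 mult_nonneg_nonneg)
    then show ?thesis using True by (simp add: zero_le_mult_iff[of "e * (y * l)"]) linarith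
  next
    case False
    then show ?thesis using assms(1) by (auto simp: crooked_sign_def)
  qed
  then show ?thesis
  proof
    assume *: "x * l \<ge> 0 \<and> e * (y * l) \<ge> 0"
    have "side_sign e (x + t * l) (y + t * (e * l)) z l" if t: "t > 0" for t
    proof -
      have "(x + t * l) * l = x * l + t * l\<^sup>2" by (simp add: power2_eq_square algebra_simps)
      then have 1: "(x + t * l) * l > 0" and 2: "e * (y * l) + t * l\<^sup>2 > 0"
        using * mult_pos_pos[OF t l] by linarith+
      have "((x + t * l) * l) * (e * (y * l) + (e * e) * t * l\<^sup>2)
            = e * ((x + t * l) * (y + t * (e * l))) * l\<^sup>2"
        by (simp add: power2_eq_square algebra_simps)
      then have "e * ((x + t * l) * (y + t * (e * l))) > 0"
        using mult_pos_pos[OF 1 2] pos unfolding e mult_1 by metis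
      then show ?thesis using 1 by (simp add: side_sign_def)
    qed
    then show ?thesis by blast
  next
    assume *: "x * l \<le> 0 \<and> e * (z * l) \<le> 0"
    have "side_sign e (x + t * (- l)) y (z + t * (- e * l)) l" if t: "t > 0" for t
    proof -
      have "(x + t * (- l)) * l = x * l - t * l\<^sup>2" by (simp add: power2_eq_square algebra_simps)
      then have 1: "(x + t * (- l)) * l < 0" and 2: "e * (z * l) - t * l\<^sup>2 < 0"
        using * mult_pos_pos[OF t l] by linarith+
      have "((x + t * (- l)) * l) * (e * (z * l) - (e * e) * t * l\<^sup>2)
            = e * ((x + t * (- l)) * (z + t * (- e * l))) * l\<^sup>2"
        by (simp add: power2_eq_square algebra_simps)
      then have "e * ((x + t * (- l)) * (z + t * (- e * l))) > 0"
        using mult_neg_neg[OF 1 2] pos unfolding e mult_1 by metis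
      then show ?thesis using 1 by (simp add: side_sign_def)
    qed
    then show ?thesis by blast
  qed
qed

section \<open>Null vectors and null frames in Minkowski space\<close>

lemma lor_simps:
  "lor (v + w) x = lor v x + lor w x" "lor x (v + w) = lor x v + lor x w"
  "lor (c *\<^sub>R v) x = c * lor v x" "lor x (c *\<^sub>R v) = c * lor x v"
  "lor (- v) x = - lor v x" "lor x (- v) = - lor x v"
  "lor (v - w) x = lor v x - lor w x" "lor x (v - w) = lor x v - lor x w"
  by (simp_all add: lor_def algebra_simps)

lemma lor_commute: "lor v w = lor w v"
  by (simp add: lor_def)

text \<open>This is Cauchy-Schwarz for the spatial parts, obtained from Lagrange's identity: the
  spatial norm of a future null vector is its third coordinate.\<close>

lemma lor_future_null_le:
  assumes "future_null v" "future_null w" shows "lor v w \<le> 0"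
proof -
  have v: "(v$1)\<^sup>2 + (v$2)\<^sup>2 = (v$3)\<^sup>2" and w: "(w$1)\<^sup>2 + (w$2)\<^sup>2 = (w$3)\<^sup>2"
    using assms by (simp_all add: future_null_def lor_def power2_eq_square)
  have "(v$3 * w$3)\<^sup>2 = ((v$1)\<^sup>2 + (v$2)\<^sup>2) * ((w$1)\<^sup>2 + (w$2)\<^sup>2)"
    by (simp add: v w power_mult_distrib)
  also have "\<dots> = (v$1 * w$1 + v$2 * w$2)\<^sup>2 + (v$1 * w$2 - v$2 * w$1)\<^sup>2"
    by (simp add: power2_eq_square algebra_simps)
  finally have "(v$1 * w$1 + v$2 * w$2)\<^sup>2 \<le> (v$3 * w$3)\<^sup>2"
    by simp
  then have "v$1 * w$1 + v$2 * w$2 \<le> v$3 * w$3"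
    by (rule power2_le_imp_le) (use assms in \<open>simp add: future_null_def\<close>)
  then show ?thesis by (simp add: lor_def)
qed

text \<open>Otherwise \<open>- v\<close> would be future null, against the sign in
  \<open>lor_future_null_le\<close>.\<close>

lemma future_nullI:
  assumes "lor v v = 0" "future_null w" "lor v w < 0" shows "future_null v"
proof (rule ccontr)
  assume "\<not> future_null v"
  then have "v$3 \<le> 0" using assms(1) by (simp add: future_null_def)
  moreover have "v$3 \<noteq> 0"
  proof
    assume "v$3 = 0"
    then have "v$1 = 0 \<and> v$2 = 0"
      using assms(1) by (simp add: lor_def sum_squares_eq_zero_iff)
    then show False using assms(3) \<open>v$3 = 0\<close> by (simp add: lor_def)
  qed
  ultimately have "future_null (- v)" using assms(1) by (simp add: future_null_def lor_simps)
  from lor_future_null_le[OF this assms(2)] show False using assms(3) by (simp add: lor_simps)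
qed

lemma det_rows_spanning:
  fixes u a b v :: "real^3"
  assumes "det (vector [u, a, b] :: real^3^3) \<noteq> 0"
  obtains \<alpha> \<beta> \<gamma> where "v = \<alpha> *\<^sub>R u + \<beta> *\<^sub>R a + \<gamma> *\<^sub>R b"
proof -
  let ?M = "vector [u, a, b] :: real^3^3"
  obtain N where N: "N ** ?M = mat 1"
    using assms invertible_det_nz[of ?M] by (auto simp: invertible_def)
  have "v = (v v* N) v* ?M"
    by (simp add: vector_matrix_mul_assoc N)
  also have "\<dots> = ((v v* N)$1) *\<^sub>R u + ((v v* N)$2) *\<^sub>R a + ((v v* N)$3) *\<^sub>R b"
    by (simp add: vector_matrix_mult_def[of _ ?M] vec_eq_iff sum_3 mult.commute)
  finally show ?thesis by (rule that)
qed

text \<open>Exchanging the null vectors reverses the orientation and negating \<open>u\<close>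
  restores it. Results about the wing of u^+ thereby carry over to the wing of u^-.\<close>

lemma null_frame_swap: "null_frame u a b \<Longrightarrow> null_frame (- u) b a"
  by (auto simp: null_frame_def spacelike_def lor_simps det_3 algebra_simps)

definition mid :: "real^5 \<Rightarrow> real^3" where "mid V = vector [V$2, V$3, V$4]"
definition height :: "real^5 \<Rightarrow> real" where "height V = V$1 + V$5"

lemma mid_scaleR: "mid (c *\<^sub>R V) = c *\<^sub>R mid V"
  by (simp add: mid_def vec_eq_iff forall_3)

lemma height_scaleR: "height (c *\<^sub>R V) = c * height V"
  by (simp add: height_def algebra_simps)

lemma form32_mid: "form32 V V = lor (mid V) (mid V) - height V * (V$5 - V$1)"
  by (simp add: form32_def lor_def mid_def height_def algebra_simps)

text \<open>The Minkowski patch is the part of nonzero height. Dividing by the height recovers the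
  vector, and the equation of the cone then determines the first and last coordinates.\<close>

lemma emb_image: "emb ` T = proj ` {V \<in> null32. height V \<noteq> 0 \<and> (1 / height V) *\<^sub>R mid V \<in> T}"
proof (intro equalityI subsetI)
  fix p assume "p \<in> emb ` T"
  then obtain v where v: "v \<in> T" "p = emb v" by blast
  define V where "V = (vector [(1 - lor v v) / 2, v$1, v$2, v$3, (1 + lor v v) / 2] :: real^5)"
  have [simp]: "mid V = v" "height V = 1"
    by (simp_all add: V_def mid_def height_def vec_eq_iff forall_3 field_simps)
  have "form32 V V = 0" by (simp add: form32_mid) (simp add: V_def field_simps)
  moreover have "V \<noteq> 0" using \<open>height V = 1\<close> by (auto simp: height_def)
  ultimately have "V \<in> null32" by (simp add: null32_def)
  moreover have "p = proj V" by (simp add: v V_def emb_def)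
  ultimately show "p \<in> proj ` {V \<in> null32. height V \<noteq> 0 \<and> (1 / height V) *\<^sub>R mid V \<in> T}"
    using v by (intro image_eqI[of _ _ V]) auto
next
  fix p assume "p \<in> proj ` {V \<in> null32. height V \<noteq> 0 \<and> (1 / height V) *\<^sub>R mid V \<in> T}"
  then obtain V where V: "V \<in> null32" "height V \<noteq> 0" "(1 / height V) *\<^sub>R mid V \<in> T" "p = proj V"
    by blast
  define v where "v = (1 / height V) *\<^sub>R mid V"
  have "lor (mid V) (mid V) = height V * (V$5 - V$1)"
    using V(1) form32_mid[of V] by (simp add: null32_def)
  then have "lor v v = (V$5 - V$1) / height V"
    using V(2) by (simp add: v_def lor_simps field_simps)
  then have "vector [(1 - lor v v) / 2, v$1, v$2, v$3, (1 + lor v v) / 2] = (1 / height V) *\<^sub>R V"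
    using V(2) unfolding vec_eq_iff forall_5
    by (simp add: v_def mid_def) (simp add: height_def field_simps)
  then have "emb v = p" using V by (simp add: emb_def proj_scaleR)
  then show "p \<in> emb ` T" using V v_def by blast
qed

text \<open>The plane of the photon contains lifts of both points. They are linearly independent, so
  the plane is their span.\<close>

lemma photon_through_infinity:
  assumes "photon \<phi>" "p_infinity \<in> \<phi>" "ideal_point c \<in> \<phi>" "future_null c"
  shows "\<phi> = proj ` {V \<in> null32. height V = 0 \<and> (\<exists>r. mid V = r *\<^sub>R c)}"
proof -
  obtain W where W: "subspace W" "dim W = 2" "\<forall>x\<in>W. \<forall>y\<in>W. form32 x y = 0" "\<phi> = proj ` (W - {0})"
    using assms(1) by (auto simp: photon_def)
  define P :: "real^5" where "P = vector [-1, 0, 0, 0, 1]"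
  define C :: "real^5" where "C = vector [0, c$1, c$2, c$3, 0]"
  have c: "lor c c = 0" "c$3 > 0" using assms(4) by (auto simp: future_null_def)
  have P: "P \<in> null32" by (simp add: P_def null32_def form32_def vec_eq_0_5)
  have C: "C \<in> null32" using c by (simp add: C_def null32_def form32_def vec_eq_0_5 lor_def)
  have mem: "V \<in> W" if "V \<in> null32" "proj V \<in> \<phi>" for V
  proof -
    obtain V' where V': "V' \<in> W" "V' \<noteq> 0" "proj V = proj V'" using \<open>proj V \<in> \<phi>\<close> W(4) by blast
    then have "V' \<in> null32" using W by (simp add: null32_def)
    then obtain r where "V = r *\<^sub>R V'" using V' \<open>V \<in> null32\<close> proj_eq_iff[of V' V] by metis
    then show ?thesis using W V' by (simp add: subspace_scale)
  qed
  have PW: "P \<in> W" and CW: "C \<in> W"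
    using mem P C assms by (simp_all add: P_def C_def p_infinity_def ideal_point_def)
  have span: "V \<in> span {P, C} \<longleftrightarrow> (\<exists>s r. V = s *\<^sub>R P + r *\<^sub>R C)" for V
    unfolding span_insert span_singleton by (auto simp: algebra_simps)
  have "C \<noteq> 0" using C by (simp add: null32_def)
  moreover have "P \<notin> span {C}" by (auto simp: span_singleton P_def C_def vec_eq_iff forall_5)
  ultimately have "independent {P, C}" "P \<noteq> C"
    by (auto simp: independent_insert span_base)
  then have "W \<subseteq> span {P, C}"
    using W PW CW by (intro card_ge_dim_independent) auto
  moreover have "span {P, C} \<subseteq> W" using PW CW W by (intro span_minimal) auto
  ultimately have "W = span {P, C}" by blast
  moreover have "V \<in> span {P, C} \<longleftrightarrow> height V = 0 \<and> (\<exists>r. mid V = r *\<^sub>R c)" for V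
  proof
    assume "V \<in> span {P, C}"
    then obtain s r where "V = s *\<^sub>R P + r *\<^sub>R C" using span by blast
    then show "height V = 0 \<and> (\<exists>r. mid V = r *\<^sub>R c)"
      by (intro conjI exI[of _ r]) (simp_all add: height_def mid_def P_def C_def vec_eq_iff forall_3)
  next
    assume "height V = 0 \<and> (\<exists>r. mid V = r *\<^sub>R c)"
    then obtain r where "height V = 0" "mid V = r *\<^sub>R c" by blast
    \<comment> \<open>Height zero gives \<open>V$1 = - V$5\<close>, so the last coordinate is the
      coefficient of \<open>P\<close>.\<close>
    then have "V = V$5 *\<^sub>R P + r *\<^sub>R C"
      by (simp add: height_def mid_def P_def C_def vec_eq_iff forall_5 forall_3)
    then show "V \<in> span {P, C}" using span by blast
  qed
  ultimately have "W - {0} = {V \<in> null32. height V = 0 \<and> (\<exists>r. mid V = r *\<^sub>R c)}"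
    using W(3) by (auto simp: null32_def)
  then show ?thesis using W by simp
qed

text \<open>Local separation in a form that survives homeomorphisms: whichever of the two open sets
  contains a given component of \<open>- S\<close>, the other one is dense at every point of
  \<open>S\<close>.\<close>

definition two_sided :: "'a::topological_space set \<Rightarrow> bool" where
  "two_sided S \<longleftrightarrow> (\<exists>A B. open A \<and> open B \<and> A \<inter> B = {} \<and> - S = A \<union> B \<and> S \<subseteq> closure A \<inter> closure B)"

lemma proj_mem_homogeneous:
  assumes "\<And>c V. c \<noteq> 0 \<Longrightarrow> Q (c *\<^sub>R V) = Q V" "V \<in> null32"
  shows "proj V \<in> proj ` {V \<in> null32. Q V} \<longleftrightarrow> Q V"
proof
  assume "proj V \<in> proj ` {V \<in> null32. Q V}"
  then obtain W where W: "W \<in> null32" "Q W" "proj W = proj V" by force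
  then obtain c where "c \<noteq> 0" "V = c *\<^sub>R W" using proj_eq_iff[OF W(1) assms(2)] by blast
  then show "Q V" using assms(1) W(2) by simp
qed (use assms(2) in blast)

text \<open>The closure of \<open>Q\<close> is taken in the whole vector space, where it may contain
  the origin; continuity of \<open>proj\<close> is available on the punctured cone only.\<close>

lemma proj_closure:
  assumes "V \<in> null32" "V \<in> closure Q" "Q \<subseteq> null32"
  shows "proj V \<in> closure (proj ` Q)"
proof -
  have "proj ` (closure Q \<inter> null32) \<subseteq> closure (proj ` Q)"
  proof -
    have "closedin (top_of_set null32) (null32 \<inter> proj -` closure (proj ` Q))"
      by (intro continuous_closedin_preimage continuous_on_proj closed_closure)
    then obtain T where T: "closed T" "null32 \<inter> proj -` closure (proj ` Q) = null32 \<inter> T"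
      by (auto simp: closedin_closed)
    have "Q \<subseteq> null32 \<inter> proj -` closure (proj ` Q)"
      using assms(3) closure_subset[of "proj ` Q"] by auto
    then have "closure Q \<subseteq> T" using T by (intro closure_minimal) auto
    then show ?thesis using T by blast
  qed
  then show ?thesis using assms by blast
qed

lemma closure_along_curve:
  fixes f :: "real \<Rightarrow> 'a::topological_space"
  assumes "continuous_on UNIV f" "\<And>t. t > 0 \<Longrightarrow> f t \<in> Q" "f 0 = V"
  shows "V \<in> closure Q"
proof -
  have "f ` closure {0<..} \<subseteq> closure (f ` {0<..})"
    by (intro image_closure_subset closure_subset) (use assms(1) continuous_on_subset in auto)
  moreover have "V \<in> f ` closure {0<..}" using assms(3) by (intro image_eqI[of _ _ 0]) auto
  moreover have "f ` {0<..} \<subseteq> Q" using assms(2) by auto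
  ultimately show ?thesis using closure_mono by blast
qed

section \<open>Crooked planes in the coordinates of a null frame\<close>

locale framed =
  fixes u a b :: "real^3"
  assumes frame: "null_frame u a b"
begin

lemma null_frame_facts:
  "lor u u > 0" "lor a a = 0" "lor b b = 0" "lor a u = 0" "lor b u = 0" "lor u a = 0" "lor u b = 0"
  "future_null a" "future_null b" "det (vector [u, a, b] :: real^3^3) > 0"
  using frame lor_commute[of u a] lor_commute[of u b]
  by (simp_all add: null_frame_def spacelike_def future_null_def)

text \<open>If the product vanished, \<open>b\<close> would be orthogonal to the whole frame, hence
  to every vector, whereas its product with the third axis is \<open>- b$3\<close>.\<close>

lemma lor_a_b_neg: "lor a b < 0"
proof -
  have "lor a b \<noteq> 0"
  proof
    assume "lor a b = 0"
    have "lor v b = 0" for v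
    proof -
      obtain \<alpha> \<beta> \<gamma> where "v = \<alpha> *\<^sub>R u + \<beta> *\<^sub>R a + \<gamma> *\<^sub>R b"
        using det_rows_spanning null_frame_facts(10) by (metis less_irrefl)
      then show ?thesis by (simp add: lor_simps null_frame_facts \<open>lor a b = 0\<close>)
    qed
    from this[of "axis 3 1"] show False
      using null_frame_facts by (simp add: lor_def axis_def future_null_def)
  qed
  then show ?thesis using lor_future_null_le[of a b] null_frame_facts by simp
qed

text \<open>Since \<open>a\<close> and \<open>b\<close> are null and orthogonal to \<open>u\<close>,
  the coefficient of \<open>a\<close> is read off by pairing with \<open>b\<close>, and
  conversely.\<close>

lemma frame_expansion:
  "v = (lor v u / lor u u) *\<^sub>R u + (lor v b / lor a b) *\<^sub>R a + (lor v a / lor a b) *\<^sub>R b"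
proof -
  obtain \<alpha> \<beta> \<gamma> where v: "v = \<alpha> *\<^sub>R u + \<beta> *\<^sub>R a + \<gamma> *\<^sub>R b"
    using det_rows_spanning null_frame_facts(10) by (metis less_irrefl)
  have "lor v u = \<alpha> * lor u u" "lor v b = \<beta> * lor a b" "lor v a = \<gamma> * lor a b"
    by (simp_all add: v lor_simps null_frame_facts lor_commute[of b a])
  then show ?thesis using v null_frame_facts lor_a_b_neg by simp
qed

lemma lor_frame: "lor v v = (lor v u)\<^sup>2 / lor u u + 2 * (lor v b) * (lor v a) / lor a b"
proof -
  have "lor (\<alpha> *\<^sub>R u + \<beta> *\<^sub>R a + \<gamma> *\<^sub>R b) (\<alpha> *\<^sub>R u + \<beta> *\<^sub>R a + \<gamma> *\<^sub>R b)
        = \<alpha>\<^sup>2 * lor u u + 2 * \<beta> * \<gamma> * lor a b" for \<alpha> \<beta> \<gamma>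
    by (simp add: lor_simps null_frame_facts lor_commute[of b a] power2_eq_square)
  from this[of "lor v u / lor u u" "lor v b / lor a b" "lor v a / lor a b"]
  have "lor v v = (lor v u / lor u u)\<^sup>2 * lor u u + 2 * (lor v b / lor a b) * (lor v a / lor a b) * lor a b"
    by (simp only: frame_expansion[symmetric])
  then show ?thesis using null_frame_facts(1) lor_a_b_neg by (simp add: power2_eq_square field_simps)
qed

lemma stem_iff: "v \<in> stem u \<longleftrightarrow> lor v u = 0 \<and> lor v a * lor v b \<ge> 0"
  using lor_a_b_neg by (auto simp: stem_def lor_frame[of v] divide_le_0_iff mult.commute mult.assoc)

text \<open>A vector orthogonal to \<open>b\<close> is a combination of \<open>u\<close> and
  \<open>b\<close>. The orientation condition then says exactly that its coefficient along
  \<open>u\<close> is positive.\<close>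

lemma open_wing:
  "{w. spacelike w \<and> lor w b = 0 \<and> (\<exists>a' b' c. null_frame w a' b' \<and> c > 0 \<and> b = c *\<^sub>R b')}
   = {w. lor w b = 0 \<and> lor w u > 0}" (is "?L = ?R")
proof (intro equalityI subsetI)
  fix w assume "w \<in> ?L"
  then obtain a' b' c where w: "spacelike w" "lor w b = 0" "null_frame w a' b'" "c > 0" "b = c *\<^sub>R b'"
    by blast
  define \<alpha> \<gamma> p q r where "\<alpha> = lor w u / lor u u" and "\<gamma> = lor w a / lor a b"
    and "p = lor a' u / lor u u" and "q = lor a' b / lor a b" and "r = lor a' a / lor a b"
  have we: "w = \<alpha> *\<^sub>R u + \<gamma> *\<^sub>R b"
    using frame_expansion[of w] w by (simp add: \<alpha>_def \<gamma>_def)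
  have a'e: "a' = p *\<^sub>R u + q *\<^sub>R a + r *\<^sub>R b"
    using frame_expansion[of a'] by (simp add: p_def q_def r_def)
  have b'e: "b' = (1 / c) *\<^sub>R b" using w by simp
  \<comment> \<open>Both null vectors point to the future, so the coefficient \<open>q\<close> of
    \<open>a'\<close> along \<open>a\<close> is nonnegative and the sign of the determinant is
    carried by \<alpha>.\<close>
  have "lor a' b \<le> 0"
    using w by (intro lor_future_null_le null_frame_facts) (auto simp: null_frame_def)
  then have q: "q \<ge> 0" using lor_a_b_neg by (simp add: q_def divide_nonpos_neg)
  have "det (vector [w, a', b'] :: real^3^3) = \<alpha> * q / c * det (vector [u, a, b] :: real^3^3)"
    unfolding we a'e b'e det_3 using w by (simp add: field_simps)
  moreover have "det (vector [w, a', b'] :: real^3^3) > 0"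
    using w by (simp add: null_frame_def)
  ultimately have "\<alpha> * q > 0"
    using null_frame_facts(10) \<open>c > 0\<close> by (simp add: zero_less_mult_iff zero_less_divide_iff)
  then have "\<alpha> > 0" using q by (simp add: zero_less_mult_iff)
  then show "w \<in> ?R" using w null_frame_facts(1) by (simp add: \<alpha>_def zero_less_divide_iff)
next
  fix w assume "w \<in> ?R"
  then have w: "lor w b = 0" "lor w u > 0" by auto
  define \<alpha> \<gamma> where "\<alpha> = lor w u / lor u u" and "\<gamma> = lor w a / lor a b"
  have we: "w = \<alpha> *\<^sub>R u + \<gamma> *\<^sub>R b"
    using frame_expansion[of w] w by (simp add: \<alpha>_def \<gamma>_def)
  have \<alpha>: "\<alpha> > 0" using w null_frame_facts(1) by (simp add: \<alpha>_def)
  \<comment> \<open>\<open>p\<close> solves \<open>lor a' w = 0\<close> and \<open>r\<close> then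
    solves \<open>lor a' a' = 0\<close>. The coefficient 1 of \<open>a\<close> leaves
    \<open>lor a' b\<close> equal to \<open>lor a b\<close>, which makes \<open>a'\<close>
    future-pointing, and keeps the orientation.\<close>
  define p where "p = - (\<gamma> * lor a b) / (\<alpha> * lor u u)"
  define r where "r = - (p\<^sup>2 * lor u u) / (2 * lor a b)"
  define a' where "a' = p *\<^sub>R u + a + r *\<^sub>R b"
  have "lor a' w = p * \<alpha> * lor u u + \<gamma> * lor a b"
    by (simp add: a'_def we lor_simps null_frame_facts)
  then have aw: "lor a' w = 0" using \<alpha> null_frame_facts(1) by (simp add: p_def)
  have "lor a' a' = p\<^sup>2 * lor u u + 2 * r * lor a b"
    by (simp add: a'_def lor_simps null_frame_facts lor_commute[of b a] power2_eq_square)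
  then have "lor a' a' = 0" using lor_a_b_neg by (simp add: r_def)
  moreover have "lor a' b = lor a b"
    by (simp add: a'_def lor_simps null_frame_facts)
  ultimately have "future_null a'"
    using lor_a_b_neg by (intro future_nullI[of a' b]) (simp_all add: null_frame_facts)
  moreover have "det (vector [w, a', b] :: real^3^3) = \<alpha> * det (vector [u, a, b] :: real^3^3)"
    unfolding we a'_def det_3 by (simp add: algebra_simps)
  then have "det (vector [w, a', b] :: real^3^3) > 0" using \<alpha> null_frame_facts(10) by simp
  moreover have sp: "spacelike w"
    using \<alpha> null_frame_facts(1) by (simp add: spacelike_def we lor_simps null_frame_facts)
  ultimately have "null_frame w a' b"
    using aw w null_frame_facts by (simp add: null_frame_def lor_commute[of b w])
  then show "w \<in> ?L" using w sp by (force intro: exI[of _ "1::real"])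
qed

lemma wing_iff: "v \<in> wing b \<longleftrightarrow> lor v b = 0 \<and> lor v u \<ge> 0"
proof -
  have "wing b = closure {w. lor w b = 0 \<and> lor w u > 0}"
    unfolding wing_def open_wing ..
  also have "\<dots> = {w. lor w b = 0 \<and> lor w u \<ge> 0}"
  proof (intro equalityI subsetI)
    fix w assume w: "w \<in> closure {w. lor w b = 0 \<and> lor w u > 0}"
    have "closed {w. lor w b = 0 \<and> lor w u \<ge> 0}"
      unfolding lor_def by (intro closed_Collect_conj closed_Collect_eq closed_Collect_le continuous_intros)
    then have "closure {w. lor w b = 0 \<and> lor w u > 0} \<subseteq> {w. lor w b = 0 \<and> lor w u \<ge> 0}"
      by (intro closure_minimal) auto
    then show "w \<in> {w. lor w b = 0 \<and> lor w u \<ge> 0}" using w by blast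
  next
    fix w assume "w \<in> {w. lor w b = 0 \<and> lor w u \<ge> 0}"
    then have w: "lor w b = 0" "lor w u \<ge> 0" by auto
    \<comment> \<open>Moving along \<open>u\<close> stays orthogonal to \<open>b\<close> and makes
      the product with \<open>u\<close> strictly positive.\<close>
    let ?f = "\<lambda>t::real. w + t *\<^sub>R u"
    have "?f ` closure {0<..} \<subseteq> closure (?f ` {0<..})"
      by (intro image_closure_subset continuous_intros closure_subset) auto
    moreover have "?f ` {0<..} \<subseteq> {w. lor w b = 0 \<and> lor w u > 0}"
      using w null_frame_facts by (auto simp: lor_simps add_nonneg_pos)
    moreover have "w \<in> ?f ` closure {0<..}" by (intro image_eqI[of _ _ 0]) auto
    ultimately show "w \<in> closure {w. lor w b = 0 \<and> lor w u > 0}"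
      using closure_mono by blast
  qed
  finally show ?thesis by auto
qed

abbreviation cx :: "real^5 \<Rightarrow> real" where "cx V \<equiv> lor (mid V) u"
text \<open>The sign compensates for \<open>lor a b < 0\<close>, so that this is a positive multiple
  of the coefficient of \<open>mid V\<close> along \<open>a\<close>; likewise \<open>cz\<close> for
  \<open>b\<close>.\<close>

abbreviation cy :: "real^5 \<Rightarrow> real" where "cy V \<equiv> - lor (mid V) b"
abbreviation cz :: "real^5 \<Rightarrow> real" where "cz V \<equiv> - lor (mid V) a"

text \<open>The inverse of the coordinate system (\<open>cx\<close>, \<open>cy\<close>,
  \<open>cz\<close>, \<open>height\<close>, \<open>V$5 - V$1\<close>). Curves on the cone are built
  by prescribing some coordinates and solving its equation for the remaining one.\<close>

definition point :: "real \<Rightarrow> real \<Rightarrow> real \<Rightarrow> real \<Rightarrow> real \<Rightarrow> real^5" where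
  "point x y z l m = (let v = (x / lor u u) *\<^sub>R u + (- y / lor a b) *\<^sub>R a + (- z / lor a b) *\<^sub>R b
     in vector [(l - m) / 2, v$1, v$2, v$3, (l + m) / 2])"

lemma mid_point:
  "mid (point x y z l m) = (x / lor u u) *\<^sub>R u + (- y / lor a b) *\<^sub>R a + (- z / lor a b) *\<^sub>R b"
  by (simp add: point_def Let_def mid_def vec_eq_iff forall_3)

lemma height_point: "height (point x y z l m) = l"
  by (simp add: point_def Let_def height_def field_simps)

lemma coords_point: "cx (point x y z l m) = x" "cy (point x y z l m) = y" "cz (point x y z l m) = z"
  using null_frame_facts(1) lor_a_b_neg
  by (simp_all add: mid_point lor_simps null_frame_facts(2-7) lor_commute[of b a])

lemma point_coords: "point (cx V) (cy V) (cz V) (height V) (V$5 - V$1) = V"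
proof -
  have "mid V = (cx V / lor u u) *\<^sub>R u + (- cy V / lor a b) *\<^sub>R a + (- cz V / lor a b) *\<^sub>R b"
    using frame_expansion[of "mid V"] by simp
  then show ?thesis
    unfolding point_def by (simp only: flip: \<open>mid V = _\<close>)
      (simp add: Let_def vec_eq_iff forall_5 mid_def height_def)
qed

lemma null_quadric:
  "V \<in> null32 \<Longrightarrow> (cx V)\<^sup>2 / lor u u - 2 * cy V * cz V / (- lor a b) = height V * (V$5 - V$1)"
  using lor_frame[of "mid V"] form32_mid[of V] by (simp add: null32_def)

lemma point_null:
  assumes "l \<noteq> 0" "x\<^sup>2 / lor u u - 2 * y * z / (- lor a b) = l * m"
  shows "point x y z l m \<in> null32"
proof -
  let ?V = "point x y z l m"
  have "?V$5 - ?V$1 = m" by (simp add: point_def Let_def field_simps)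
  moreover have "lor (mid ?V) b = - y" "lor (mid ?V) a = - z"
    using coords_point(2,3)[of x y z l m] by linarith+
  ultimately have "form32 ?V ?V = 0"
    using assms lor_frame[of "mid ?V"] form32_mid[of ?V]
    by (simp add: height_point coords_point(1))
  moreover have "?V \<noteq> 0" using height_point[of x y z l m] assms by (auto simp: height_def)
  ultimately show ?thesis by (simp add: null32_def)
qed

lemma continuous_on_point:
  assumes "continuous_on S f1" "continuous_on S f2" "continuous_on S f3" "continuous_on S f4"
    "continuous_on S f5"
  shows "continuous_on S (\<lambda>t. point (f1 t) (f2 t) (f3 t) (f4 t) (f5 t))"
  unfolding point_def Let_def divide_inverse
  by (intro continuous_on_vector_5 continuous_intros assms) auto

abbreviation crooked_at :: "real^5 \<Rightarrow> bool" where
  "crooked_at V \<equiv> crooked_sign (cx V) (cy V) (cz V) (height V)"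

abbreviation side_at :: "real \<Rightarrow> real^5 \<Rightarrow> bool" where
  "side_at e V \<equiv> side_sign e (cx V) (cy V) (cz V) (height V)"

text \<open>\<open>crooked_sign_perturb\<close> moves along \<open>l\<close>, hence gives nothing at
  l = 0. Here the points at infinity are reached along explicit curves inside the surface.\<close>

lemma crooked_in_closure_finite_part:
  assumes "V \<in> null32" "crooked_at V" "height V = 0"
  shows "V \<in> closure {V \<in> null32. crooked_at V \<and> height V \<noteq> 0}" (is "_ \<in> closure ?Q")
proof -
  define q k m where "q = lor u u" and "k = - lor a b" and "m = V$5 - V$1"
  have q: "q > 0" and k: "k > 0" using null_frame_facts lor_a_b_neg by (simp_all add: q_def k_def)
  have eq: "(cx V)\<^sup>2 / q = 2 * cy V * cz V / k"
    using null_quadric[OF assms(1)] assms(3) by (simp add: q_def k_def)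
  \<comment> \<open>At l = 0 a crooked point with x nonzero would have y = 0 or z = 0, and the
    equation of the cone would then force x = 0.\<close>
  have x: "cx V = 0"
    using assms(2,3) eq q k by (auto simp: crooked_sign_def)
  then have yz: "cy V = 0 \<or> cz V = 0" using eq k by simp
  have V: "V = point 0 (cy V) (cz V) 0 m"
    using point_coords[of V] x assms(3) by (simp add: m_def)
  have inQ: "point x y z l m \<in> ?Q"
    if "l \<noteq> 0" "x\<^sup>2 / q - 2 * y * z / k = l * m" "crooked_sign x y z l" for x y z l
    using that point_null[of l x y z m] by (simp add: q_def k_def coords_point height_point)
  \<comment> \<open>With l = t * s one has l * m \<le> 0. If one of y, z is nonzero, solving the
    equation of the cone at x = 0 for the other gives y * z \<ge> 0, so the curve stays on the
    stem.\<close>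
  define s :: real where "s = (if m \<le> 0 then 1 else -1)"
  have s: "s \<noteq> 0" "s * m \<le> 0" by (auto simp: s_def)
  have sm: "t * (s * m) \<le> 0" if "t > 0" for t
    using that s by (simp add: mult_nonneg_nonpos)
  consider "cz V \<noteq> 0" | "cy V \<noteq> 0" | "cy V = 0" "cz V = 0" by blast
  then show ?thesis
  proof cases
    case 1
    then have [simp]: "cy V = 0" using yz by simp
    show ?thesis
    proof (rule closure_along_curve)
      show "continuous_on UNIV (\<lambda>t. point 0 (- (t * (s * m)) * k / (2 * cz V)) (cz V) (t * s) m)"
        unfolding divide_inverse by (intro continuous_on_point continuous_intros)
      show "point 0 (- (t * (s * m)) * k / (2 * cz V)) (cz V) (t * s) m \<in> ?Q" if "t > 0" for t
      proof (rule inQ)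
        have "- (t * (s * m)) * k / (2 * cz V) * cz V = - (t * (s * m)) * k / 2"
          using 1 by simp
        also have "\<dots> \<ge> 0" using sm[OF that] k by (simp add: mult_nonpos_nonneg)
        finally show "crooked_sign 0 (- (t * (s * m)) * k / (2 * cz V)) (cz V) (t * s)"
          unfolding crooked_sign_def by blast
      qed (use that 1 k s in \<open>simp_all\<close>)
      show "point 0 (- (0 * (s * m)) * k / (2 * cz V)) (cz V) (0 * s) m = V"
        using V by simp
    qed
  next
    case 2
    then have [simp]: "cz V = 0" using yz by simp
    show ?thesis
    proof (rule closure_along_curve)
      show "continuous_on UNIV (\<lambda>t. point 0 (cy V) (- (t * (s * m)) * k / (2 * cy V)) (t * s) m)"
        unfolding divide_inverse by (intro continuous_on_point continuous_intros)
      show "point 0 (cy V) (- (t * (s * m)) * k / (2 * cy V)) (t * s) m \<in> ?Q" if "t > 0" for t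
      proof (rule inQ)
        have "cy V * (- (t * (s * m)) * k / (2 * cy V)) = - (t * (s * m)) * k / 2"
          using 2 by simp
        also have "\<dots> \<ge> 0" using sm[OF that] k by (simp add: mult_nonpos_nonneg)
        finally show "crooked_sign 0 (cy V) (- (t * (s * m)) * k / (2 * cy V)) (t * s)"
          unfolding crooked_sign_def by blast
      qed (use that 2 k s in \<open>simp_all\<close>)
      show "point 0 (cy V) (- (0 * (s * m)) * k / (2 * cy V)) (0 * s) m = V"
        using V by simp
    qed
  next
    case 3
    \<comment> \<open>With y = z = 0 the equation reads x^2 / q = l * m, so l must have the sign of
      \<open>m\<close>, opposite to that of \<open>s\<close>. Taking l of order t^2 makes x linear
      in t. The curve lies on a wing for either sign of x * l.\<close>
    show ?thesis
    proof (rule closure_along_curve)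
      show "continuous_on UNIV (\<lambda>t. point (t * sqrt (q * \<bar>m\<bar>)) 0 0 (- s * t\<^sup>2) m)"
        by (intro continuous_on_point continuous_intros)
      show "point (t * sqrt (q * \<bar>m\<bar>)) 0 0 (- s * t\<^sup>2) m \<in> ?Q" if "t > 0" for t
      proof (rule inQ)
        have m: "\<bar>m\<bar> = - s * m" by (simp add: s_def)
        have "(t * sqrt (q * \<bar>m\<bar>))\<^sup>2 = t\<^sup>2 * (q * \<bar>m\<bar>)"
          using q by (simp add: power_mult_distrib)
        then show "(t * sqrt (q * \<bar>m\<bar>))\<^sup>2 / q - 2 * 0 * 0 / k = - s * t\<^sup>2 * m"
          using q by (simp add: m)
        show "crooked_sign (t * sqrt (q * \<bar>m\<bar>)) 0 0 (- s * t\<^sup>2)"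
          by (simp add: crooked_sign_def linear)
      qed (use that s in simp)
      show "point (0 * sqrt (q * \<bar>m\<bar>)) 0 0 (- s * 0\<^sup>2) m = V"
        using V 3 by simp
    qed
  qed
qed

text \<open>At nonzero height this lifts the moves of \<open>crooked_sign_perturb\<close> to the
  cone. Points at infinity are limits of such points, and the closure is closed.\<close>

lemma crooked_in_closure_side:
  assumes "V \<in> null32" "crooked_at V" "e = 1 \<or> e = -1"
  shows "V \<in> closure {V \<in> null32. side_at e V}"
proof -
  have *: "V \<in> closure {V \<in> null32. side_at e V}"
    if V: "V \<in> null32" "crooked_at V" "height V \<noteq> 0" for V
  proof -
    define q k l where "q = lor u u" and "k = - lor a b" and "l = height V"
    have l: "l \<noteq> 0" using V by (simp add: l_def)
    \<comment> \<open>The coordinates x, y, z move linearly and l is fixed; the fifth coordinate is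
      solved from the equation of the cone, which keeps the curve null.\<close>
    define f where "f dx dy dz t = (let x = cx V + t * dx; y = cy V + t * dy; z = cz V + t * dz
       in point x y z l ((x\<^sup>2 / q - 2 * y * z / k) / l))" for dx dy dz t
    have null: "f dx dy dz t \<in> null32" for dx dy dz t
      using l by (auto simp: f_def Let_def q_def k_def intro!: point_null)
    have coords: "cx (f dx dy dz t) = cx V + t * dx" "cy (f dx dy dz t) = cy V + t * dy"
      "cz (f dx dy dz t) = cz V + t * dz" "height (f dx dy dz t) = l" for dx dy dz t
      by (simp_all only: f_def Let_def coords_point height_point)
    have cont: "continuous_on UNIV (f dx dy dz)" for dx dy dz
      unfolding f_def Let_def divide_inverse by (intro continuous_on_point continuous_intros)
    have f0: "f dx dy dz 0 = V" for dx dy dz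
    proof -
      have "((cx V)\<^sup>2 / q - 2 * cy V * cz V / k) / l = V$5 - V$1"
        using null_quadric[OF V(1)] l by (simp add: q_def k_def l_def field_simps)
      then show ?thesis using point_coords[of V] by (simp add: f_def Let_def l_def)
    qed
    have clos: "V \<in> closure {V \<in> null32. side_at e V}"
      if side: "\<forall>t>0. side_sign e (cx V + t * dx) (cy V + t * dy) (cz V + t * dz) l" for dx dy dz
    proof (rule closure_along_curve[OF cont _ f0])
      show "f dx dy dz t \<in> {V \<in> null32. side_at e V}" if "t > 0" for t
        using side that null unfolding mem_Collect_eq coords by blast
    qed
    from crooked_sign_perturb[OF V(2,3) assms(3)] show ?thesis
      using clos[of l "e * l" 0] clos[of "- l" 0 "- e * l"]
      by (simp only: l_def mult_zero_right add_0_right) blast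
  qed
  show ?thesis
  proof (cases "height V = 0")
    case True
    have "V \<in> closure {V \<in> null32. crooked_at V \<and> height V \<noteq> 0}"
      using crooked_in_closure_finite_part assms True by simp
    also have "\<dots> \<subseteq> closure {V \<in> null32. side_at e V}"
      by (rule closure_minimal) (use * in auto)
    finally show ?thesis .
  qed (use * assms in simp)
qed

lemma compactified_crooked_plane_eq:
  assumes "photon \<phi>" "p_infinity \<in> \<phi>" "ideal_point b \<in> \<phi>"
    and "photon \<psi>" "p_infinity \<in> \<psi>" "ideal_point a \<in> \<psi>"
  shows "emb ` (stem u \<union> wing b \<union> wing a) \<union> \<phi> \<union> \<psi> = proj ` {V \<in> null32. crooked_at V}"
proof -
  \<comment> \<open>The wing of \<open>a\<close> is the wing of u^+ for the director
    \<open>- u\<close>. Hence the two wing conditions carry opposite signs of x * l.\<close>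
  interpret swap: framed "- u" b a
    by unfold_locales (rule null_frame_swap[OF frame])
  have "(1 / height V) *\<^sub>R mid V \<in> stem u \<union> wing b \<union> wing a \<longleftrightarrow> crooked_at V"
    if "height V \<noteq> 0" for V
  proof -
    have "(1 / height V) *\<^sub>R mid V \<in> stem u \<union> wing b \<union> wing a \<longleftrightarrow>
      crooked_sign (1 / height V * cx V) (1 / height V * cy V) (1 / height V * cz V) (1 / height V * height V)"
      using that unfolding Un_iff stem_iff wing_iff swap.wing_iff crooked_sign_def
      by (auto simp: lor_simps zero_le_mult_iff zero_le_divide_iff divide_le_0_iff mult.commute)
    moreover have "1 / height V \<noteq> 0" using that by simp
    ultimately show ?thesis by (simp only: crooked_sign_scale simp_thms)
  qed
  then have 1: "emb ` (stem u \<union> wing b \<union> wing a) = proj ` {V \<in> null32. height V \<noteq> 0 \<and> crooked_at V}"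
    unfolding emb_image by (metis (no_types, lifting))
  have ray: "(\<exists>r. v = r *\<^sub>R b) \<longleftrightarrow> lor v u = 0 \<and> lor v b = 0"
            "(\<exists>r. v = r *\<^sub>R a) \<longleftrightarrow> lor v u = 0 \<and> lor v a = 0" for v
    using frame_expansion[of v] null_frame_facts by (auto simp: lor_simps)
  have "crooked_at V \<longleftrightarrow> (\<exists>r. mid V = r *\<^sub>R b) \<or> (\<exists>r. mid V = r *\<^sub>R a)"
    if V: "V \<in> null32" "height V = 0" for V
  proof -
    have "(cx V)\<^sup>2 * lor a b = - 2 * cy V * cz V * lor u u"
      using null_quadric[OF V(1)] V(2) null_frame_facts(1) lor_a_b_neg by (simp add: field_simps)
    then show ?thesis
      unfolding ray crooked_sign_def using V(2) null_frame_facts(1) lor_a_b_neg by auto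
  qed
  then have "{V \<in> null32. height V = 0 \<and> (\<exists>r. mid V = r *\<^sub>R b)} \<union> {V \<in> null32. height V = 0 \<and> (\<exists>r. mid V = r *\<^sub>R a)}
    = {V \<in> null32. height V = 0 \<and> crooked_at V}" by blast
  then have 2: "\<phi> \<union> \<psi> = proj ` {V \<in> null32. height V = 0 \<and> crooked_at V}"
    using photon_through_infinity[OF assms(1-3)] photon_through_infinity[OF assms(4-6)] null_frame_facts
    by (simp flip: image_Un)
  show ?thesis unfolding Un_assoc[of _ \<phi>] 1 2 by (simp flip: image_Un) (rule arg_cong[of _ _ "image proj"], blast)
qed

lemma two_sided_crooked: "two_sided (proj ` {V \<in> null32. crooked_at V})"
  unfolding two_sided_def
proof (intro exI conjI)
  let ?S = "proj ` {V \<in> null32. crooked_at V}"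
  let ?A = "\<lambda>e. proj ` {V \<in> null32. side_at e V}"
  have hc: "crooked_at (c *\<^sub>R V) = crooked_at V" if "c \<noteq> 0" for c V
    using crooked_sign_scale[OF that, of "cx V" "cy V" "cz V" "height V"]
    by (simp add: mid_scaleR height_scaleR lor_simps)
  have hs: "side_at e (c *\<^sub>R V) = side_at e V" if "c \<noteq> 0" for c e V
    using side_sign_scale[OF that, of e "cx V" "cy V" "cz V" "height V"]
    by (simp add: mid_scaleR height_scaleR lor_simps)
  have memc: "proj V \<in> ?S \<longleftrightarrow> crooked_at V" if "V \<in> null32" for V
    using hc that by (rule proj_mem_homogeneous)
  have mems: "proj V \<in> ?A e \<longleftrightarrow> side_at e V" if "V \<in> null32" for e V
    using hs that by (rule proj_mem_homogeneous)
  show op: "open (?A e)" for e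
  proof -
    have "open {V. side_at e V}"
      unfolding side_sign_def lor_def mid_def height_def vector_3
      by (intro open_Collect_disj open_Collect_conj open_Collect_less continuous_intros)
    moreover have "{V \<in> null32. proj V \<in> ?A e} = null32 \<inter> {V. side_at e V}"
      using mems by blast
    ultimately show ?thesis by (simp add: open_ein3_iff openin_open_Int)
  qed
  show "open (?A (-1))" by (rule op)
  have k: "- lor a b > 0" using lor_a_b_neg by simp
  show "?A 1 \<inter> ?A (-1) = {}"
  proof (rule equals0I)
    fix p assume p: "p \<in> ?A 1 \<inter> ?A (-1)"
    obtain V where "V \<in> null32" "p = proj V" by (rule ein3_cases)
    then have "side_at 1 V \<and> side_at (-1) V" using p by (simp only: Int_iff mems)
    then show False using side_sign_disjoint by blast
  qed
  show "- ?S = ?A 1 \<union> ?A (-1)"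
  proof (rule Set.set_eqI)
    fix p
    obtain V where V: "V \<in> null32" "p = proj V" by (rule ein3_cases)
    show "p \<in> - ?S \<longleftrightarrow> p \<in> ?A 1 \<union> ?A (-1)"
      unfolding V(2) Compl_iff Un_iff mems[OF V(1)] memc[OF V(1)]
      by (rule not_crooked_sign_iff[OF null_frame_facts(1) k null_quadric[OF V(1)]])
  qed
  show "?S \<subseteq> closure (?A 1) \<inter> closure (?A (-1))"
  proof
    fix p assume "p \<in> ?S"
    then obtain V where V: "V \<in> null32" "crooked_at V" "p = proj V" by blast
    have "p \<in> closure (?A e)" if "e = 1 \<or> e = -1" for e
      unfolding V(3) using V that
      by (intro proj_closure crooked_in_closure_side) auto
    then show "p \<in> closure (?A 1) \<inter> closure (?A (-1))" by blast
  qed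
qed

end

section \<open>Regularity of the regions bounded by crooked surfaces\<close>

lemma two_sided_homeomorphic_image:
  fixes f :: "'a::topological_space \<Rightarrow> 'a"
  assumes S: "two_sided S" and f: "continuous_on UNIV f" "continuous_on UNIV g"
    and inv: "\<And>x. g (f x) = x" "\<And>x. f (g x) = x"
  shows "two_sided (f ` S)"
proof -
  have fg: "f ` T = g -` T" for T using inv by (auto simp: image_iff) metis
  have op: "open (f ` T)" if "open T" for T
    using f(2) that by (simp add: fg open_vimage)
  have cl: "f ` closure T \<subseteq> closure (f ` T)" for T
    by (intro image_closure_subset closure_subset closed_closure) (use f continuous_on_subset in auto)
  obtain A B where AB: "open A" "open B" "A \<inter> B = {}" "- S = A \<union> B" "S \<subseteq> closure A \<inter> closure B"
    using S by (auto simp: two_sided_def)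
  have "f ` A \<inter> f ` B = {}" unfolding fg using AB(3) by blast
  moreover have "- (f ` S) = f ` A \<union> f ` B"
    by (simp only: fg flip: vimage_Compl vimage_Un AB(4))
  moreover have "f ` S \<subseteq> closure (f ` A) \<inter> closure (f ` B)"
    using AB(5) cl[of A] cl[of B] by blast
  ultimately show ?thesis
    unfolding two_sided_def using op[OF AB(1)] op[OF AB(2)]
    by (intro exI[of _ "f ` A"] exI[of _ "f ` B"] conjI)
qed

lemma crooked_surface_two_sided:
  assumes "crooked_surface S" shows "two_sided S"
proof -
  obtain u C A where *: "compactified_crooked_plane u C" "A \<in> carrier SO32" "S = act A ` C"
    using assms by (auto simp: crooked_surface_def)
  from *(1) obtain a b \<phi> \<psi> where frame: "null_frame u a b"
    and photons: "photon \<phi>" "p_infinity \<in> \<phi>" "ideal_point b \<in> \<phi>"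
      "photon \<psi>" "p_infinity \<in> \<psi>" "ideal_point a \<in> \<psi>"
    and C: "C = emb ` (stem u \<union> wing b \<union> wing a) \<union> \<phi> \<union> \<psi>"
    unfolding compactified_crooked_plane_def by (elim exE conjE)
  interpret framed u a b using frame by unfold_locales
  have C2: "two_sided C"
    unfolding C compactified_crooked_plane_eq[OF photons] by (rule two_sided_crooked)
  interpret group SO32 by (rule SO32_group)
  have inv: "act (inv\<^bsub>SO32\<^esub> A) (act A p) = p" "act A (act (inv\<^bsub>SO32\<^esub> A) p) = p" for p
    using *(2) by (simp_all add: act_one flip: act_mult)
  show ?thesis
    unfolding *(3)
    by (rule two_sided_homeomorphic_image[OF C2 continuous_act[OF *(2)]
          continuous_act[OF inv_closed[OF *(2)]] inv])
qed

lemma two_sided_closed: "two_sided S \<Longrightarrow> closed S"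
  unfolding two_sided_def closed_def by (metis open_Un)

lemma two_sided_component_regular:
  fixes S :: "'a::topological_space set"
  assumes S: "two_sided S" and U: "U \<in> components (- S)" "open U"
  shows "interior (closure U) = U" "closure U \<subseteq> U \<union> S"
proof -
  obtain A B where AB: "open A" "open B" "A \<inter> B = {}" "- S = A \<union> B" "S \<subseteq> closure A \<inter> closure B"
    using S by (auto simp: two_sided_def)
  have "connected U" "U \<subseteq> - S" using U in_components_connected in_components_subset by blast+
  then have "U \<inter> A = {} \<or> U \<inter> B = {}"
    using connectedD[of U A B] AB by blast
  then obtain D where D: "open D" "U \<inter> D = {}" "S \<subseteq> closure D" using AB by blast
  then have "closure U \<inter> D = {}" by (simp add: open_Int_closure_eq_empty inf_commute)
  \<comment> \<open>An open set that misses \<open>D\<close> also misses \<open>closure D\<close>,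
    and therefore all of \<open>S\<close>.\<close>
  then have "interior (closure U) \<inter> closure D = {}"
    using interior_subset[of "closure U"] open_interior open_Int_closure_eq_empty by blast
  moreover show cl: "closure U \<subseteq> U \<union> S"
  proof -
    have "closedin (top_of_set (- S)) U" by (rule closedin_component[OF U(1)])
    then obtain T where "closed T" "U = - S \<inter> T" by (auto simp: closedin_closed)
    then show ?thesis using closure_minimal[of U T] by blast
  qed
  ultimately have "interior (closure U) \<subseteq> U"
    using D interior_subset[of "closure U"] by blast
  then show "interior (closure U) = U"
    using interior_maximal[OF closure_subset U(2)] by blast
qed

subsection \<open>Ping-pong\<close>

abbreviation flip :: "'i \<times> bool \<Rightarrow> 'i \<times> bool" where "flip l \<equiv> (fst l, \<not> snd l)"

lemma reduced_word_Cons: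
  "reduced_word (l # w) \<longleftrightarrow> (w = [] \<or> hd w \<noteq> flip l) \<and> reduced_word w"
  unfolding reduced_word_def by (cases w) (auto simp: prod_eq_iff)

text \<open>An abstract action by homeomorphisms of a compact connected space. The geometry of
  crooked surfaces enters only through the properties of the sets \<open>D l\<close>, with
  \<open>D (i, True)\<close> and \<open>D (i, False)\<close> in the roles of U_i^+ and
  U_i^-.\<close>

locale ping_pong = group G for G :: "('g, 'm) monoid_scheme" (structure) +
  fixes ac :: "'g \<Rightarrow> 'x::topological_space \<Rightarrow> 'x"
    and I :: "'i set"
    and \<eta> :: "'i \<Rightarrow> 'g"
    and D :: "'i \<times> bool \<Rightarrow> 'x set"
  assumes ac_one: "ac \<one> p = p"
    and ac_mult: "\<lbrakk>g \<in> carrier G; h \<in> carrier G\<rbrakk> \<Longrightarrow> ac (g \<otimes> h) p = ac g (ac h p)"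
    and ac_cont: "g \<in> carrier G \<Longrightarrow> continuous_on UNIV (ac g)"
    and compact_X: "compact (UNIV :: 'x set)"
    and connected_X: "connected (UNIV :: 'x set)"
    and finite_I: "finite I"
    and \<eta>_carrier: "i \<in> I \<Longrightarrow> \<eta> i \<in> carrier G"
    and D_open: "fst l \<in> I \<Longrightarrow> open (D l)"
    and D_ne: "fst l \<in> I \<Longrightarrow> D l \<noteq> {}"
    and D_disjoint: "\<lbrakk>fst l \<in> I; fst m \<in> I; l \<noteq> m\<rbrakk> \<Longrightarrow> closure (D l) \<inter> closure (D m) = {}"
    and D_regular: "i \<in> I \<Longrightarrow> interior (closure (D (i, True))) = D (i, True)"
    and \<eta>_D: "i \<in> I \<Longrightarrow> ac (\<eta> i) ` D (i, False) = - closure (D (i, True))"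
begin

definition letter :: "'i \<times> bool \<Rightarrow> 'g" where
  "letter l = (if snd l then \<eta> (fst l) else inv (\<eta> (fst l)))"

text \<open>Words are over indices instead of group elements, since \<eta> is not assumed injective;
  \<open>free_group_\<Gamma>\<close> translates between the two.\<close>

definition val :: "('i \<times> bool) list \<Rightarrow> 'g" where
  "val w = foldr (\<lambda>l g. letter l \<otimes> g) w \<one>"

abbreviation letters :: "('i \<times> bool) set" where "letters \<equiv> I \<times> UNIV"

definition \<Gamma> :: "'g set" where "\<Gamma> = generate G (\<eta> ` I)"
definition F :: "'x set" where "F = - (\<Union>l\<in>letters. D l)"
definition \<Omega> :: "'x set" where "\<Omega> = (\<Union>g\<in>\<Gamma>. ac g ` F)"

lemma ac_inv [simp]:
  assumes "g \<in> carrier G" shows "ac (inv g) (ac g p) = p" "ac g (ac (inv g) p) = p"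
  using assms by (simp_all flip: ac_mult add: ac_one)

lemma ac_image_Compl:
  assumes "g \<in> carrier G" shows "ac g ` (- T) = - ac g ` T"
proof -
  have "bij (ac g)" using ac_inv[OF assms] by (intro o_bij[of "ac (inv g)"]) (auto simp: fun_eq_iff)
  then show ?thesis by (rule bij_image_Compl_eq)
qed

lemma ac_image_mult:
  "\<lbrakk>g \<in> carrier G; h \<in> carrier G\<rbrakk> \<Longrightarrow> ac (g \<otimes> h) ` T = ac g ` ac h ` T"
  by (auto simp: ac_mult image_image)

lemma ac_image_inv: "g \<in> carrier G \<Longrightarrow> ac (inv g) ` ac g ` T = T" "g \<in> carrier G \<Longrightarrow> ac g ` ac (inv g) ` T = T"
  by (simp_all add: image_image)

lemma ac_image_vimage: "g \<in> carrier G \<Longrightarrow> ac g ` T = ac (inv g) -` T"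
  by (auto simp: image_iff) (metis ac_inv(2))

lemma ac_open: "\<lbrakk>g \<in> carrier G; open T\<rbrakk> \<Longrightarrow> open (ac g ` T)"
  using ac_cont[of "inv g"] by (simp add: ac_image_vimage open_vimage)

lemma ac_closed: "\<lbrakk>g \<in> carrier G; closed T\<rbrakk> \<Longrightarrow> closed (ac g ` T)"
  using ac_open[of g "- T"] by (simp add: ac_image_Compl open_Compl closed_def)

lemma ac_closure:
  assumes g: "g \<in> carrier G" shows "ac g ` closure T = closure (ac g ` T)"
proof (rule antisym)
  show "closure (ac g ` T) \<subseteq> ac g ` closure T"
    by (intro closure_minimal ac_closed g image_mono closure_subset closed_closure)
  show "ac g ` closure T \<subseteq> closure (ac g ` T)"
    by (intro image_closure_subset closure_subset closed_closure continuous_on_subset[OF ac_cont] g) auto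
qed

lemma letter_carrier [simp]: "l \<in> letters \<Longrightarrow> letter l \<in> carrier G"
  using \<eta>_carrier by (auto simp: letter_def)

lemma letter_flip: "l \<in> letters \<Longrightarrow> letter (flip l) = inv (letter l)"
  using \<eta>_carrier by (auto simp: letter_def)

lemma val_simps [simp]: "val [] = \<one>" "val (l # w) = letter l \<otimes> val w"
  by (simp_all add: val_def)

lemma val_carrier [simp]: "set w \<subseteq> letters \<Longrightarrow> val w \<in> carrier G"
  by (induction w) auto

lemma \<Gamma>_subgroup: "subgroup \<Gamma> G"
  unfolding \<Gamma>_def using \<eta>_carrier by (intro generate_is_subgroup) auto

lemma \<Gamma>_carrier: "g \<in> \<Gamma> \<Longrightarrow> g \<in> carrier G"
  using \<Gamma>_subgroup by (rule subgroup.mem_carrier)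

lemma letter_\<Gamma>: "l \<in> letters \<Longrightarrow> letter l \<in> \<Gamma>"
  unfolding \<Gamma>_def letter_def by (auto intro: generate.incl generate.inv)

lemma letter_D:
  assumes "l \<in> letters" shows "ac (letter l) ` (- D (flip l)) = closure (D l)"
proof -
  obtain i s where l: "l = (i, s)" "i \<in> I" using assms by auto
  show ?thesis
  proof (cases s)
    case True
    then show ?thesis using l \<eta>_carrier by (simp add: letter_def ac_image_Compl \<eta>_D)
  next
    case False
    \<comment> \<open>Regular openness writes the complement as the closure of an image under
      \<open>\<eta> i\<close>; a homeomorphism commutes with closure, so the inverse can be
      applied.\<close>
    have "- D (i, True) = closure (- closure (D (i, True)))"
      using D_regular[OF l(2)] by (simp add: closure_complement)
    also have "\<dots> = ac (\<eta> i) ` closure (D (i, False))"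
      using l \<eta>_carrier by (simp add: \<eta>_D ac_closure)
    finally show ?thesis using l False \<eta>_carrier by (simp add: letter_def ac_image_inv)
  qed
qed

text \<open>This is \<open>letter_D\<close> for the inverse letter, turned around and
  complemented.\<close>

lemma letter_D':
  assumes "l \<in> letters" shows "ac (letter l) ` (- closure (D (flip l))) = D l"
proof -
  have "ac (letter l) ` closure (D (flip l)) = - D l"
  proof -
    have "flip l \<in> letters" using assms by auto
    from letter_D[OF this] have "closure (D (flip l)) = ac (inv (letter l)) ` (- D l)"
      by (simp add: letter_flip[OF assms])
    then show ?thesis using assms by (simp only: ac_image_inv letter_carrier)
  qed
  then show ?thesis using assms by (simp add: ac_image_Compl)
qed

lemma closure_disjoint: "\<lbrakk>l \<in> letters; m \<in> letters; l \<noteq> m\<rbrakk> \<Longrightarrow> closure (D l) \<inter> closure (D m) = {}"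
  by (rule D_disjoint) auto

text \<open>The gain from a closed set to an open one comes from the disjointness of the closures:
  \<open>closure (D m)\<close> avoids all of \<open>closure (D (flip l))\<close>, not only its
  interior.\<close>

lemma letter_closure_subset:
  assumes "l \<in> letters" "m \<in> letters" "m \<noteq> flip l"
  shows "ac (letter l) ` closure (D m) \<subseteq> D l"
proof -
  have "closure (D m) \<subseteq> - closure (D (flip l))" using closure_disjoint[of m "flip l"] assms by auto
  then show ?thesis using letter_D'[OF assms(1)] by blast
qed

lemma letter_F: "l \<in> letters \<Longrightarrow> ac (letter l) ` F \<subseteq> closure (D l)"
  using letter_D[of l] unfolding F_def by fastforce

lemma D_disjoint_F: "l \<in> letters \<Longrightarrow> D l \<inter> F = {}"
  by (auto simp: F_def)

text \<open>The letter applied first sends \<open>F\<close> only into a closure, because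
  \<open>F\<close> contains the boundaries of the sets \<open>D m\<close>. Each further letter lands
  in the open set by \<open>letter_closure_subset\<close>.\<close>

lemma reduced_word_F:
  assumes "reduced_word w" "set w \<subseteq> letters" "w \<noteq> []"
  shows "ac (val w) ` F \<subseteq> (if length w = 1 then closure (D (hd w)) else D (hd w))"
  using assms
proof (induction w)
  case (Cons l w)
  have c: "letter l \<in> carrier G" "val w \<in> carrier G" "l \<in> letters" using Cons by auto
  show ?case
  proof (cases "w = []")
    case True
    then show ?thesis using c letter_F[of l] by simp
  next
    case False
    have "ac (val w) ` F \<subseteq> closure (D (hd w))"
      using Cons False closure_subset[of "D (hd w)"]
      by (auto simp: reduced_word_Cons split: if_splits)
    then have "ac (letter l \<otimes> val w) ` F \<subseteq> ac (letter l) ` closure (D (hd w))"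
      using c by (auto simp: ac_mult)
    also have "\<dots> \<subseteq> D l"
      using Cons.prems False by (intro letter_closure_subset) (auto simp: reduced_word_Cons)
    finally show ?thesis using False by simp
  qed
qed simp

text \<open>A trivial reduced word beginning with \<open>l\<close> would put \<open>F\<close> inside
  \<open>closure (D l)\<close>. By connectedness \<open>D (flip l)\<close> has a boundary point,
  which lies in \<open>F\<close> but outside \<open>closure (D l)\<close>. Using the inverse letter
  makes this work with a single generator.\<close>

lemma val_reduced_ne_one:
  assumes "reduced_word w" "set w \<subseteq> letters" "w \<noteq> []"
  shows "val w \<noteq> \<one>"
proof
  assume one: "val w = \<one>"
  define l where "l = hd w"
  have l: "l \<in> letters" using assms by (auto simp: l_def dest: hd_in_set)
  have F: "F \<subseteq> closure (D l)"
    using reduced_word_F[OF assms] closure_subset[of "D l"]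
    by (auto simp: one ac_one l_def split: if_splits)
  have "D (flip l) \<noteq> {}" "D l \<noteq> {}" "D l \<inter> D (flip l) = {}" "open (D (flip l))"
    using l D_ne D_open closure_disjoint[of l "flip l"] closure_subset[of "D l"] closure_subset[of "D (flip l)"]
    by fastforce+
  then have "\<not> closed (D (flip l))"
    using connected_X unfolding connected_clopen by auto
  then obtain p where p: "p \<in> closure (D (flip l))" "p \<notin> D (flip l)"
    using closure_subset_eq by blast
  have "p \<notin> closure (D m)" if "m \<in> letters" "m \<noteq> flip l" for m
    using closure_disjoint[of m "flip l"] that p l by auto
  note away = this
  have "p \<notin> D m" if "m \<in> letters" for m
    using away[OF that] p(2) closure_subset[of "D m"] by (cases "m = flip l") auto
  then have "p \<in> F" unfolding F_def by blast
  moreover have "p \<notin> closure (D l)" using away[OF l] by (metis prod.collapse snd_conv)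
  ultimately show False using F by blast
qed

lemma reduced_val_letter:
  assumes "reduced_word w" "set w \<subseteq> letters" "l \<in> letters"
  shows "\<exists>w'. reduced_word w' \<and> set w' \<subseteq> letters \<and> letter l \<otimes> val w = val w'"
proof (cases "w \<noteq> [] \<and> hd w = flip l")
  case True
  then obtain w' where w: "w = flip l # w'" by (cases w) auto
  have "letter l \<otimes> val w = val w'"
    using assms w by (simp add: letter_flip flip: m_assoc)
  then show ?thesis using assms w by (auto simp: reduced_word_Cons)
next
  case False
  then have "reduced_word (l # w)" using assms by (auto simp: reduced_word_Cons)
  then show ?thesis using assms by (intro exI[of _ "l # w"]) auto
qed

lemma \<Gamma>_reduced:
  assumes "g \<in> \<Gamma>"
  obtains w where "reduced_word w" "set w \<subseteq> letters" "g = val w"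
proof -
  \<comment> \<open>Generalising to multiplication onto an arbitrary reduced word lets the product
    case apply the two induction hypotheses in succession.\<close>
  have "\<exists>w'. reduced_word w' \<and> set w' \<subseteq> letters \<and> g \<otimes> val w = val w'"
    if "reduced_word w" "set w \<subseteq> letters" for w
    using assms that unfolding \<Gamma>_def
  proof (induction arbitrary: w)
    case one
    then show ?case by auto
  next
    case (incl h)
    then obtain i where "i \<in> I" "h = letter (i, True)" by (auto simp: letter_def)
    then show ?case using reduced_val_letter[of w "(i, True)"] incl by auto
  next
    case (inv h)
    then obtain i where "i \<in> I" "inv h = letter (i, False)" by (auto simp: letter_def)
    then show ?case using reduced_val_letter[of w "(i, False)"] inv by auto
  next
    case (eng h1 h2)
    have \<eta>: "\<eta> ` I \<subseteq> carrier G" using \<eta>_carrier by blast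
    have h: "h1 \<in> carrier G" "h2 \<in> carrier G"
      using generate_in_carrier[OF \<eta>] eng.hyps by blast+
    obtain w2 where w2: "reduced_word w2" "set w2 \<subseteq> letters" "h2 \<otimes> val w = val w2"
      using eng.IH(2) eng.prems by blast
    obtain w1 where "reduced_word w1" "set w1 \<subseteq> letters" "h1 \<otimes> val w2 = val w1"
      using eng.IH(1) w2(1,2) by blast
    then show ?case using h w2 eng.prems by (auto simp: m_assoc)
  qed
  from this[of "[]"] show thesis
    using that \<Gamma>_carrier[OF assms] by (auto simp: reduced_word_def)
qed

section \<open>Translates of the fundamental domain\<close>

lemma overlap_F:
  assumes "g \<in> \<Gamma>" "ac g ` F \<inter> F \<noteq> {}" shows "g \<in> insert \<one> (letter ` letters)"
proof -
  obtain w where w: "reduced_word w" "set w \<subseteq> letters" "g = val w"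
    using \<Gamma>_reduced assms(1) by metis
  have "length w \<le> 1"
  proof (rule ccontr)
    assume "\<not> length w \<le> 1"
    then have ne: "w \<noteq> []" "length w \<noteq> 1" by auto
    then have "ac g ` F \<subseteq> D (hd w)" using reduced_word_F[OF w(1,2)] w(3) by simp
    then have "ac g ` F \<inter> F \<subseteq> D (hd w) \<inter> F" by (rule Int_mono) simp
    moreover have "hd w \<in> letters" using w(2) hd_in_set[OF ne(1)] by blast
    ultimately show False using D_disjoint_F[of "hd w"] assms(2) by simp
  qed
  then consider "w = []" | l where "w = [l]" by (cases w) auto
  then show ?thesis using w by cases auto
qed

lemma finite_overlap: "finite {g \<in> \<Gamma>. ac g ` F \<inter> F \<noteq> {}}"
proof (rule finite_subset)
  show "{g \<in> \<Gamma>. ac g ` F \<inter> F \<noteq> {}} \<subseteq> insert \<one> (letter ` letters)"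
  proof
    fix g assume "g \<in> {g \<in> \<Gamma>. ac g ` F \<inter> F \<noteq> {}}"
    then show "g \<in> insert \<one> (letter ` letters)" using overlap_F[of g] by simp
  qed
  show "finite (insert \<one> (letter ` letters))"
    using finite_I by simp
qed

text \<open>
  An open set between \<open>F\<close> and the union of \<open>F\<close> with its neighbouring translates: its
  complement consists of the points of each \<open>D l\<close> lying beyond \<open>ac (letter l) ` F\<close>.
\<close>

definition N :: "'x set" where
  "N = - (\<Union>l\<in>letters. \<Union>m\<in>letters - {flip l}. ac (letter l) ` closure (D m))"

lemma open_N: "open N"
proof -
  have fin: "finite letters" using finite_I by simp
  have "closed (\<Union>m\<in>letters - {flip l}. ac (letter l) ` closure (D m))" if "l \<in> letters" for l
    using that fin by (intro closed_UN ballI ac_closed closed_closure letter_carrier finite_Diff)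
  then show ?thesis unfolding N_def by (intro open_Compl closed_UN[OF fin] ballI)
qed

lemma F_subset_N: "F \<subseteq> N"
proof
  fix p assume "p \<in> F"
  have "p \<notin> ac (letter l) ` closure (D m)" if "l \<in> letters" "m \<in> letters - {flip l}" for l m
  proof -
    have "ac (letter l) ` closure (D m) \<subseteq> D l" using letter_closure_subset[of l m] that by simp
    then show ?thesis using D_disjoint_F[OF that(1)] \<open>p \<in> F\<close> by (meson disjoint_iff subsetD)
  qed
  then show "p \<in> N" unfolding N_def by blast
qed

text \<open>Pulled back by \<open>letter l\<close>, a point of \<open>N\<close> in
  \<open>D l\<close> avoids \<open>closure (D (flip l))\<close> by \<open>letter_D'\<close> and the
  other closures by the choice of \<open>N\<close>, so it lands in \<open>F\<close>.\<close>

lemma N_subset: "N \<subseteq> F \<union> (\<Union>l\<in>letters. ac (letter l) ` F)"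
proof
  fix p assume p: "p \<in> N"
  show "p \<in> F \<union> (\<Union>l\<in>letters. ac (letter l) ` F)"
  proof (cases "p \<in> F")
    case False
    then obtain l where l: "l \<in> letters" "p \<in> D l" unfolding F_def by blast
    then obtain q where q: "p = ac (letter l) q" "q \<notin> closure (D (flip l))"
      using letter_D'[of l] by blast
    have "q \<notin> closure (D m)" if "m \<in> letters" "m \<noteq> flip l" for m
      using p that l q unfolding N_def by blast
    then have "q \<in> F" using q closure_subset unfolding F_def by blast
    then show ?thesis using l q by blast
  qed simp
qed

text \<open>Replacing the closed set \<open>F\<close> by an open one gives both the openness of
  \<Omega> and the open covers needed for compact subsets.\<close>

lemma \<Omega>_eq_N: "\<Omega> = (\<Union>g\<in>\<Gamma>. ac g ` N)"
proof (rule antisym)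
  show "\<Omega> \<subseteq> (\<Union>g\<in>\<Gamma>. ac g ` N)" unfolding \<Omega>_def using F_subset_N by blast
  show "(\<Union>g\<in>\<Gamma>. ac g ` N) \<subseteq> \<Omega>"
  proof clarify
    fix g p assume g: "g \<in> \<Gamma>" and "p \<in> N"
    then have "p \<in> F \<union> (\<Union>l\<in>letters. ac (letter l) ` F)" using N_subset by blast
    then show "ac g p \<in> \<Omega>"
    proof
      assume "p \<in> (\<Union>l\<in>letters. ac (letter l) ` F)"
      then obtain l q where l: "l \<in> letters" "q \<in> F" "p = ac (letter l) q" by blast
      then have "ac g p = ac (g \<otimes> letter l) q" using g by (simp add: ac_mult \<Gamma>_carrier)
      moreover have "g \<otimes> letter l \<in> \<Gamma>"
        using g l letter_\<Gamma> \<Gamma>_subgroup by (simp add: subgroup.m_closed)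
      ultimately show ?thesis using l unfolding \<Omega>_def by blast
    qed (use g in \<open>auto simp: \<Omega>_def\<close>)
  qed
qed

lemma open_\<Omega>: "open \<Omega>"
  unfolding \<Omega>_eq_N by (intro open_UN ballI ac_open open_N \<Gamma>_carrier)

lemma \<Omega>_invariant:
  assumes "g \<in> \<Gamma>" shows "ac g ` \<Omega> = \<Omega>"
proof -
  have sub: "ac h ` \<Omega> \<subseteq> \<Omega>" if h: "h \<in> \<Gamma>" for h
  proof -
    have "ac h ` ac k ` F \<subseteq> \<Omega>" if k: "k \<in> \<Gamma>" for k
      using h k subgroup.m_closed[OF \<Gamma>_subgroup h k] unfolding \<Omega>_def
      by (auto simp: \<Gamma>_carrier simp flip: ac_image_mult)
    then show ?thesis unfolding \<Omega>_def by blast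
  qed
  have "inv g \<in> \<Gamma>" using assms \<Gamma>_subgroup by (simp add: subgroup.m_inv_closed)
  then have "ac g ` ac (inv g) ` \<Omega> \<subseteq> ac g ` \<Omega>" using sub by blast
  then show ?thesis using sub[OF assms] assms by (simp add: ac_image_inv \<Gamma>_carrier)
qed

text \<open>A finite subcover by translates of \<open>N\<close> suffices, because each of these lies
  in finitely many translates of \<open>F\<close>.\<close>

lemma compact_covered:
  assumes "K \<subseteq> \<Omega>" "compact K"
  obtains J where "finite J" "J \<subseteq> \<Gamma>" "K \<subseteq> (\<Union>g\<in>J. ac g ` F)"
proof -
  obtain J where J: "J \<subseteq> \<Gamma>" "finite J" "K \<subseteq> (\<Union>g\<in>J. ac g ` N)"
    using compactE_image[OF assms(2), of \<Gamma> "\<lambda>g. ac g ` N"] assms(1) ac_open open_N \<Gamma>_carrier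
    unfolding \<Omega>_eq_N by metis
  define J' where "J' = J \<union> (\<lambda>(g, l). g \<otimes> letter l) ` (J \<times> letters)"
  have "J' \<subseteq> \<Gamma>" using J letter_\<Gamma> \<Gamma>_subgroup by (auto simp: J'_def subgroup.m_closed)
  moreover have "finite J'" using J finite_I by (simp add: J'_def)
  moreover have "ac g ` N \<subseteq> (\<Union>g\<in>J'. ac g ` F)" if g: "g \<in> J" for g
  proof -
    have "ac g ` N \<subseteq> ac g ` F \<union> (\<Union>l\<in>letters. ac g ` ac (letter l) ` F)"
      using N_subset by blast
    also have "\<dots> = ac g ` F \<union> (\<Union>l\<in>letters. ac (g \<otimes> letter l) ` F)"
      using g J by (simp add: ac_image_mult \<Gamma>_carrier subset_iff)
    also have "\<dots> \<subseteq> (\<Union>g\<in>J'. ac g ` F)" using g by (force simp: J'_def)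
    finally show ?thesis .
  qed
  ultimately show thesis using that J by (meson UN_least subset_trans)
qed

text \<open>If g takes a point of k F to a point of h F, then h^-1 g k makes \<open>F\<close>
  overlap itself. There are finitely many choices for h and k by \<open>compact_covered\<close> and
  for this product by \<open>finite_overlap\<close>.\<close>

lemma finite_overlap_compact:
  assumes "K \<subseteq> \<Omega>" "compact K"
  shows "finite {g \<in> \<Gamma>. ac g ` K \<inter> K \<noteq> {}}"
proof -
  obtain J where J: "finite J" "J \<subseteq> \<Gamma>" "K \<subseteq> (\<Union>g\<in>J. ac g ` F)"
    using compact_covered assms by metis
  define T where "T = {g \<in> \<Gamma>. ac g ` F \<inter> F \<noteq> {}}"
  have "g \<in> (\<lambda>(h, t, k). h \<otimes> t \<otimes> inv k) ` (J \<times> T \<times> J)" if g: "g \<in> \<Gamma>" "ac g ` K \<inter> K \<noteq> {}" for g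
  proof -
    obtain p where "p \<in> K" "ac g p \<in> K" using g by blast
    then obtain k h x y where k: "k \<in> J" "x \<in> F" "p = ac k x" and h: "h \<in> J" "y \<in> F" "ac g p = ac h y"
      using J by blast
    have c: "g \<in> carrier G" "k \<in> carrier G" "h \<in> carrier G" and \<Gamma>: "k \<in> \<Gamma>" "h \<in> \<Gamma>"
      using g k h J \<Gamma>_carrier by auto
    define t where "t = inv h \<otimes> (g \<otimes> k)"
    have "ac t x = ac (inv h) (ac g (ac k x))" using c by (simp add: t_def ac_mult)
    then have "ac t x = y" using k h c by simp
    moreover have "t \<in> \<Gamma>"
      unfolding t_def using g \<Gamma> \<Gamma>_subgroup by (simp add: subgroup.m_closed subgroup.m_inv_closed)
    ultimately have "t \<in> T" using k h unfolding T_def by blast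
    moreover have "g = h \<otimes> t \<otimes> inv k"
      using c by (simp add: t_def m_assoc[symmetric]) (simp add: m_assoc)
    ultimately show ?thesis using k h by (intro image_eqI[of _ _ "(h, t, k)"]) auto
  qed
  then have "{g \<in> \<Gamma>. ac g ` K \<inter> K \<noteq> {}} \<subseteq> (\<lambda>(h, t, k). h \<otimes> t \<otimes> inv k) ` (J \<times> T \<times> J)" by blast
  then show ?thesis
    by (rule finite_subset) (use J finite_overlap in \<open>simp add: T_def\<close>)
qed

lemma compact_F: "compact F"
proof -
  have "closed F" unfolding F_def by (intro closed_Compl open_UN ballI D_open) auto
  then show ?thesis using compact_X compact_Int_closed[of UNIV F] by simp
qed

text \<open>A word in the generators is lifted to indices by a choice of preimages under \<eta>. The
  choice is injective on the generators, so reduced words stay reduced.\<close>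

lemma free_group_\<Gamma>: "free_group (G\<lparr>carrier := \<Gamma>\<rparr>)"
proof -
  let ?H = "G\<lparr>carrier := \<Gamma>\<rparr>"
  let ?X = "\<eta> ` I"
  have "group ?H" by (rule subgroup.subgroup_is_group[OF \<Gamma>_subgroup group_axioms])
  moreover have X: "?X \<subseteq> \<Gamma>" unfolding \<Gamma>_def by (auto intro: generate.incl)
  moreover have "generate ?H ?X = \<Gamma>"
    using generate_consistent[OF X \<Gamma>_subgroup] by (simp add: \<Gamma>_def)
  moreover have "word_value ?H w \<noteq> \<one>\<^bsub>?H\<^esub>"
    if w: "w \<noteq> []" "set w \<subseteq> ?X \<times> UNIV" "reduced_word w" for w
  proof -
    define idx where "idx = inv_into I \<eta>"
    have idx: "idx x \<in> I" "\<eta> (idx x) = x" if "x \<in> ?X" for x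
      using that by (simp_all add: idx_def inv_into_into f_inv_into_f)
    define w' where "w' = map (\<lambda>(x, s). (idx x, s)) w"
    have "word_value ?H w = val w'" using w(2) unfolding w'_def
    proof (induction w)
      case (Cons l w)
      obtain x s where l: "l = (x, s)" "x \<in> ?X" using Cons by (cases l) auto
      have "inv\<^bsub>?H\<^esub> x = inv x" using m_inv_consistent[OF \<Gamma>_subgroup] X l by auto
      then show ?case using Cons l idx by (simp add: word_value_def letter_def)
    qed (simp add: word_value_def)
    moreover have "val w' \<noteq> \<one>"
    proof (rule val_reduced_ne_one)
      show "w' \<noteq> []" "set w' \<subseteq> letters" using w idx by (auto simp: w'_def)
      have "reduced_word (map (\<lambda>(x, s). (idx x, s)) w)" using w(2,3)
      proof (induction w)
        case (Cons l w)
        have "inj_on idx ?X" by (auto simp: idx_def inj_on_inv_into)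
        then show ?case using Cons
          by (cases w) (auto simp: reduced_word_Cons inj_on_eq_iff split_beta)
      qed (simp add: reduced_word_def)
      then show "reduced_word w'" by (simp add: w'_def)
    qed
    ultimately show ?thesis by simp
  qed
  ultimately show ?thesis unfolding free_group_def free_basis_def by (intro conjI exI[of _ ?X]) auto
qed

end

subsection \<open>Orbit spaces\<close>

lemma compact_space_orbit_space:
  assumes "compact F" "F \<subseteq> X" "orbit_of \<Gamma> ` X = orbit_of \<Gamma> ` F"
  shows "compact_space (orbit_space \<Gamma> X)"
proof -
  have op: "openin (orbit_space \<Gamma> X) V \<longleftrightarrow>
      V \<subseteq> orbit_of \<Gamma> ` X \<and> openin (top_of_set X) {x \<in> X. orbit_of \<Gamma> x \<in> V}" for V
    unfolding orbit_space_def openin_quotient_topology by simp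
  have "openin (orbit_space \<Gamma> X) (orbit_of \<Gamma> ` X)"
  proof -
    have "{x \<in> X. orbit_of \<Gamma> x \<in> orbit_of \<Gamma> ` X} = X" by blast
    then show ?thesis unfolding op by (simp only: openin_subtopology_self order_refl simp_thms)
  qed
  then have top: "topspace (orbit_space \<Gamma> X) = orbit_of \<Gamma> ` X"
    using op by (metis openin_subset openin_topspace subset_antisym)
  have "continuous_map (top_of_set X) (orbit_space \<Gamma> X) (orbit_of \<Gamma>)"
    unfolding continuous_map_def top using op by auto
  moreover have "compactin (top_of_set X) F" using assms(1,2) by (simp add: compactin_subtopology)
  ultimately have "compactin (orbit_space \<Gamma> X) (orbit_of \<Gamma> ` F)" by (rule image_compactin[rotated])
  then show ?thesis using assms(3) top by (simp add: compact_space_def)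
qed

section \<open>Crooked Schottky domains as ping-pong data\<close>

lemma crooked_schottky_ping_pong:
  assumes \<eta>: "\<And>i. i \<in> {1..n} \<Longrightarrow> \<eta> i \<in> carrier SO32"
    and "crooked_schottky_domain n \<eta> U"
  shows "ping_pong SO32 act {1..n} \<eta> (\<lambda>(i, s). U i s)"
proof -
  from assms(2) obtain S where S: "\<forall>i\<in>{1..n}. \<forall>s. crooked_surface (S i s) \<and> U i s \<in> components (- S i s)"
    and S_disj: "disjoint_family_on (\<lambda>(i, s). S i s) ({1..n} \<times> UNIV)"
    and U_disj: "disjoint_family_on (\<lambda>(i, s). U i s) ({1..n} \<times> UNIV)"
    and \<eta>_U: "\<forall>i\<in>{1..n}. act (\<eta> i) ` U i False = - closure (U i True)"
    unfolding crooked_schottky_domain_def by (elim exE conjE)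
  have side: "open (U i s)" "interior (closure (U i s)) = U i s" "closure (U i s) \<subseteq> U i s \<union> S i s"
    "U i s \<noteq> {}" if "i \<in> {1..n}" for i s
  proof -
    have two: "two_sided (S i s)" and comp: "U i s \<in> components (- S i s)"
      using bspec[OF S that] crooked_surface_two_sided by simp_all
    show op: "open (U i s)" using open_component_ein3[OF two_sided_closed[OF two] comp] .
    show "interior (closure (U i s)) = U i s" "closure (U i s) \<subseteq> U i s \<union> S i s"
      using two_sided_component_regular[OF two comp op] by blast+
    show "U i s \<noteq> {}" using comp in_components_nonempty by blast
  qed
  \<comment> \<open>Each open region misses the closure of the other, and what the closures add lies
    on the surfaces, which are disjoint.\<close>
  have disj: "closure (U i s) \<inter> closure (U j t) = {}"
    if "i \<in> {1..n}" "j \<in> {1..n}" "(i, s) \<noteq> (j, t)" for i j s t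
  proof -
    have U: "U i s \<inter> U j t = {}" and SS: "S i s \<inter> S j t = {}"
      using disjoint_family_onD[OF U_disj _ _ that(3)] disjoint_family_onD[OF S_disj _ _ that(3)] that
      by auto
    have "closure (U i s) \<inter> U j t = {}" "U i s \<inter> closure (U j t) = {}"
      using U open_Int_closure_eq_empty[OF side(1)[OF that(1)], of s "U j t"]
        open_Int_closure_eq_empty[OF side(1)[OF that(2)], of t "U i s"] by (simp_all add: Int_commute)
    then show ?thesis using side(3)[OF that(1), of s] side(3)[OF that(2), of t] SS by blast
  qed
  show ?thesis
  proof (intro ping_pong.intro ping_pong_axioms.intro SO32_group act_one act_mult continuous_act
      compact_UNIV_ein3 connected_UNIV_ein3 finite_atLeastAtMost \<eta>)
    show "open (case l of (i, s) \<Rightarrow> U i s)" "(case l of (i, s) \<Rightarrow> U i s) \<noteq> {}"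
      if "fst l \<in> {1..n}" for l
      using side(1,4)[OF that] by (simp_all add: split_beta)
    show "closure (case l of (i, s) \<Rightarrow> U i s) \<inter> closure (case m of (i, s) \<Rightarrow> U i s) = {}"
      if "fst l \<in> {1..n}" "fst m \<in> {1..n}" "l \<noteq> m" for l m
      using disj[OF that(1,2), of "snd l" "snd m"] that(3) by (simp add: split_beta)
  qed (simp_all only: prod.case side(2) bspec[OF \<eta>_U])
qed

theorem mainTheorem2:
  fixes n :: nat
    and \<eta> :: "nat \<Rightarrow> real^5^5"
    and U :: "nat \<Rightarrow> bool \<Rightarrow> ein3 set"
    and \<Gamma> :: "(real^5^5) set"
    and F \<Omega> :: "ein3 set"
  assumes "\<And>i. i \<in> {1..n} \<Longrightarrow> \<eta> i \<in> carrier SO32"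
    and "\<Gamma> = generate SO32 (\<eta> ` {1..n})"
    and "crooked_schottky_domain n \<eta> U"
    and "F = (\<Inter>i\<in>{1..n}. - (U i False \<union> U i True))"
    and "\<Omega> = (\<Union>\<gamma>\<in>\<Gamma>. act \<gamma> ` F)"
  shows "free_group (SO32\<lparr>carrier := \<Gamma>\<rparr>)
       \<and> open \<Omega>
       \<and> acts_properly_on \<Gamma> \<Omega>
       \<and> compact_space (orbit_space \<Gamma> \<Omega>)"
proof -
  interpret P: ping_pong SO32 act "{1..n}" \<eta> "\<lambda>(i, s). U i s"
    using assms(1,3) by (rule crooked_schottky_ping_pong)
  have \<Gamma>: "\<Gamma> = P.\<Gamma>" unfolding assms(2) P.\<Gamma>_def ..
  have F: "F = P.F" unfolding assms(4) P.F_def by (auto simp: UNIV_bool)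
  have \<Omega>: "\<Omega> = P.\<Omega>" unfolding assms(5) P.\<Omega>_def \<Gamma> F ..
  have one: "\<one>\<^bsub>SO32\<^esub> \<in> \<Gamma>" unfolding \<Gamma> by (rule subgroup.one_closed[OF P.\<Gamma>_subgroup])
  have mult: "g \<otimes>\<^bsub>SO32\<^esub> h \<in> \<Gamma>" if "g \<in> \<Gamma>" "h \<in> \<Gamma>" for g h
    using that unfolding \<Gamma> by (rule subgroup.m_closed[OF P.\<Gamma>_subgroup])
  have inv: "inv\<^bsub>SO32\<^esub> g \<in> \<Gamma>" if "g \<in> \<Gamma>" for g
    using that unfolding \<Gamma> by (rule subgroup.m_inv_closed[OF P.\<Gamma>_subgroup])
  have carr: "g \<in> carrier SO32" if "g \<in> \<Gamma>" for g
    using that unfolding \<Gamma> by (rule P.\<Gamma>_carrier)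
  have F\<Omega>: "F \<subseteq> \<Omega>"
  proof
    fix p assume "p \<in> F"
    then show "p \<in> \<Omega>"
      unfolding assms(5) by (intro UN_I[OF one] image_eqI[of _ _ p]) (simp_all add: act_one)
  qed
  \<comment> \<open>Every orbit in \<Omega> meets \<open>F\<close>, so the compact set
    \<open>F\<close> maps onto the orbit space.\<close>
  have orbits: "orbit_of \<Gamma> ` \<Omega> = orbit_of \<Gamma> ` F"
  proof (intro equalityI subsetI)
    show "B \<in> orbit_of \<Gamma> ` \<Omega>" if "B \<in> orbit_of \<Gamma> ` F" for B
      using that F\<Omega> by blast
  next
    fix B assume "B \<in> orbit_of \<Gamma> ` \<Omega>"
    then obtain g p where g: "g \<in> \<Gamma>" "p \<in> F" "B = orbit_of \<Gamma> (act g p)"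
      unfolding assms(5) by blast
    have gc: "g \<in> carrier SO32" using g(1) by (rule carr)
    have "orbit_of \<Gamma> (act g p) = orbit_of \<Gamma> p"
    proof (intro equalityI subsetI)
      fix q assume "q \<in> orbit_of \<Gamma> (act g p)"
      then obtain h where h: "h \<in> \<Gamma>" "q = act h (act g p)" by (auto simp: orbit_of_def)
      then have "h \<otimes>\<^bsub>SO32\<^esub> g \<in> \<Gamma>" "q = act (h \<otimes>\<^bsub>SO32\<^esub> g) p"
        using g(1) gc mult[of h g] carr[of h] by (simp_all add: act_mult)
      then show "q \<in> orbit_of \<Gamma> p" unfolding orbit_of_def by blast
    next
      fix q assume "q \<in> orbit_of \<Gamma> p"
      then obtain h where h: "h \<in> \<Gamma>" "q = act h p" by (auto simp: orbit_of_def)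
      then have "h \<otimes>\<^bsub>SO32\<^esub> inv\<^bsub>SO32\<^esub> g \<in> \<Gamma>" "q = act (h \<otimes>\<^bsub>SO32\<^esub> inv\<^bsub>SO32\<^esub> g) (act g p)"
        using g(1) gc mult[of h "inv\<^bsub>SO32\<^esub> g"] inv[of g] carr[of h] by (simp_all add: act_mult)
      then show "q \<in> orbit_of \<Gamma> (act g p)" unfolding orbit_of_def by blast
    qed
    then show "B \<in> orbit_of \<Gamma> ` F" using g by blast
  qed
  have "compact F" unfolding F by (rule P.compact_F)
  then have "compact_space (orbit_space \<Gamma> \<Omega>)" using F\<Omega> orbits by (rule compact_space_orbit_space)
  moreover have "acts_properly_on \<Gamma> \<Omega>"
    unfolding acts_properly_on_def \<Gamma> \<Omega> using P.\<Omega>_invariant P.finite_overlap_compact by blast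
  ultimately show ?thesis
    using P.free_group_\<Gamma> P.open_\<Omega> unfolding \<Gamma> \<Omega> by blast
qed

end
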